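(* Let $k\ge2$ be an integer and let $\mathbb T_n^{\rm rr}$ be a uniform random recursive tree with $n$ vertices. Then its $k$-cut number satisfies $$n^{-1}(\ln n)^{1/k}\,\mathcal K(\mathbb T_n^{\rm rr})\xrightarrow{d}(k!)^{1/k}\,\Gamma\Big(1+\frac1k\Big)\quad\text{as } n\to\infty,$$ i.e. convergence in distribution to a constant.
   Context: The $k$-cut number $\mathcal K(T)$ of a finite rooted tree $T$ is the random total number of cuts made in the following procedure. Step 1: choose a vertex uniformly at random from the component that currently contains the root and cut it once. Step 2: if this vertex has now been cut $k$ times, remove it together with the edges attached to it. Step 3: if the root has been removed, stop; otherwise go to Step 1. When the tree is random, the tree is sampled first and the procedure is then run on it. Uniform random recursive tree: $\mathbb T_1^{\rm rr}$ is the single vertex labelled $1$ (the root); given $\mathbb T_{n-1}^{\rm rr}$, choose one of its vertices uniformly at random and attach to it a new child labelled $n$ to obtain $\mathbb T_n^{\rm rr}$. $\Gamma(\cdot)$ is the gamma function. *)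

theory Defs
  imports "HOL-Probability.Probability"
begin

text \<open>
  A rooted tree is given by its vertex set, its root, and its edges as (parent, child) pairs.
  The definitions below make sense for every finite graph with a distinguished vertex; this is
  needed because the cutting procedure passes through forests.
\<close>

record 'v rooted_graph =
  verts :: "'v set"
  edges :: "('v \<times> 'v) set"
  root_vertex :: 'v

definition root_component :: "'v rooted_graph \<Rightarrow> 'v set" where
  "root_component T = {v \<in> verts T. (root_vertex T, v) \<in> (edges T \<union> (edges T)\<inverse>)\<^sup>*}"

definition remove_vertex :: "'v \<Rightarrow> 'v rooted_graph \<Rightarrow> 'v rooted_graph" where
  "remove_vertex v T =
     T\<lparr>verts := verts T - {v}, edges := {(a, b) \<in> edges T. a \<noteq> v \<and> b \<noteq> v}\<rparr>"

definition cut_vertex ::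
  "nat \<Rightarrow> 'v \<Rightarrow> 'v rooted_graph \<times> ('v \<Rightarrow> nat) \<Rightarrow> 'v rooted_graph \<times> ('v \<Rightarrow> nat)" where
  "cut_vertex k v = (\<lambda>(T, c).
     ((if Suc (c v) \<ge> k then remove_vertex v T else T), c(v := Suc (c v))))"

text \<open>
  The state of the procedure is the current graph together with the number of cuts already
  received by each vertex. The result is the law of the number of cuts still to be made until
  the root has been removed. The finiteness test only serves termination, and so does the
  comparison with at-least \<open>k\<close> (rather than exactly \<open>k\<close>) cuts above: started from
  zero cuts with \<open>k \<ge> 1\<close>, a vertex is removed exactly at its \<open>k\<close>-th cut.
\<close>

function remaining_cuts :: "nat \<Rightarrow> 'v rooted_graph \<times> ('v \<Rightarrow> nat) \<Rightarrow> nat pmf" where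
  "remaining_cuts k (T, c) =
     (if finite (verts T) \<and> root_vertex T \<in> verts T
      then bind_pmf (pmf_of_set (root_component T))
             (\<lambda>v. map_pmf Suc (remaining_cuts k (cut_vertex k v (T, c))))
      else return_pmf 0)"
  by auto

lemma cut_vertex_decreases:
  assumes "finite (verts T)" "v \<in> verts T"
  shows "(\<Sum>u\<in>verts (fst (cut_vertex k v (T, c))). Suc (k - snd (cut_vertex k v (T, c)) u))
           < (\<Sum>u\<in>verts T. Suc (k - c u))"
proof (cases "Suc (c v) \<ge> k")
  case True
  then have "(\<Sum>u\<in>verts (fst (cut_vertex k v (T, c))). Suc (k - snd (cut_vertex k v (T, c)) u))
      = (\<Sum>u\<in>verts T - {v}. Suc (k - c u))"
    by (auto simp: cut_vertex_def remove_vertex_def intro!: sum.cong)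
  also have "\<dots> < (\<Sum>u\<in>verts T. Suc (k - c u))"
    using assms by (simp add: sum.remove[of "verts T" v])
  finally show ?thesis .
next
  case False
  then have "(\<Sum>u\<in>verts (fst (cut_vertex k v (T, c))). Suc (k - snd (cut_vertex k v (T, c)) u))
      = (\<Sum>u\<in>verts T. Suc (k - (c(v := Suc (c v))) u))"
    by (simp add: cut_vertex_def)
  also have "\<dots> < (\<Sum>u\<in>verts T. Suc (k - c u))"
    using assms False by (intro sum_strict_mono_ex1) auto
  finally show ?thesis .
qed

termination remaining_cuts
proof (relation "Wellfounded.measure (\<lambda>(k, T, c). \<Sum>u\<in>verts T. Suc (k - c u))")
  fix k and T :: "'v rooted_graph" and c v
  assume *: "finite (verts T) \<and> root_vertex T \<in> verts T"
    and v: "v \<in> set_pmf (pmf_of_set (root_component T))"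
  have "root_vertex T \<in> root_component T" "finite (root_component T)"
    using * by (auto simp: root_component_def)
  then have "set_pmf (pmf_of_set (root_component T)) = root_component T"
    by (intro set_pmf_of_set) auto
  with v have "v \<in> verts T"
    by (simp add: root_component_def)
  with * cut_vertex_decreases[of T v k c]
  show "((k, cut_vertex k v (T, c)), k, T, c) \<in> Wellfounded.measure (\<lambda>(k, T, c). \<Sum>u\<in>verts T. Suc (k - c u))"
    by (auto simp: case_prod_unfold)
qed auto

definition cut_number :: "nat \<Rightarrow> 'v rooted_graph \<Rightarrow> nat pmf" where
  "cut_number k T = remaining_cuts k (T, \<lambda>_. 0)"

definition attach_child :: "'v \<Rightarrow> 'v \<Rightarrow> 'v rooted_graph \<Rightarrow> 'v rooted_graph" where
  "attach_child u w T = T\<lparr>verts := insert w (verts T), edges := insert (u, w) (edges T)\<rparr>"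

text \<open>The value at 0 is a dummy; there is no recursive tree without vertices.\<close>

fun random_recursive_tree :: "nat \<Rightarrow> nat rooted_graph pmf" where
  "random_recursive_tree 0 = return_pmf \<lparr>verts = {1}, edges = {}, root_vertex = 1\<rparr>"
| "random_recursive_tree (Suc 0) = return_pmf \<lparr>verts = {1}, edges = {}, root_vertex = 1\<rparr>"
| "random_recursive_tree (Suc (Suc n)) =
     bind_pmf (random_recursive_tree (Suc n)) (\<lambda>T.
       map_pmf (\<lambda>u. attach_child u (Suc (Suc n)) T) (pmf_of_set (verts T)))"

lemma random_recursive_tree_verts_root:
  "n \<ge> 1 \<Longrightarrow> T \<in> set_pmf (random_recursive_tree n) \<Longrightarrow> verts T = {1..n} \<and> root_vertex T = 1"
proof (induction n arbitrary: T rule: random_recursive_tree.induct)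
  case (3 n)
  then obtain T' u where "T' \<in> set_pmf (random_recursive_tree (Suc n))"
    and "T = attach_child u (Suc (Suc n)) T'"
    by auto
  with "3.IH"[of T'] show ?case
    by (auto simp: attach_child_def)
qed auto

definition cut_number_rrt :: "nat \<Rightarrow> nat \<Rightarrow> nat pmf" where
  "cut_number_rrt k n = bind_pmf (random_recursive_tree n) (cut_number k)"

end

theory Submission
  imports Defs "HOL-Real_Asymp.Real_Asymp"
begin

text \<open>
  The proof is a second moment argument. Its starting point is the embedding in continuous time:
  give every vertex an independent Poisson clock of rate \<open>1\<close> and cut a vertex whenever its clock
  rings. Among the vertices of the root component the next clock to ring is uniform, so the cuts
  made inside the root component follow the law of the procedure. If \<open>C\<^sub>t\<close> is the size of the root
  component at time \<open>t\<close> (with \<open>C\<^sub>t = 0\<close> once the root is gone), cuts happen at rate \<open>C\<^sub>t\<close>, and the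
  area \<open>\<integral> C\<^sub>t dt\<close> is a sum of \<open>K\<close> independent standard exponential variables, where \<open>K\<close> is the number of
  cuts. Hence \<open>E K = \<integral> E C\<^sub>t dt\<close> and
  \<open>E (K (K + 1)) = E (\<integral> C\<^sub>t dt)\<^sup>2 = 2 \<integral>\<integral>\<^bsub>s<t\<^esub> E (C\<^sub>s C\<^sub>t) ds dt\<close>.
  A vertex belongs to the root component at time \<open>t\<close> iff the clocks on its ancestral line, its own
  included, have all rung fewer than \<open>k\<close> times, so the integrands are sums over vertices (pairs of vertices) of products of the tail
  \<open>q(t) = P(Poisson(t) < k)\<close> along ancestral lines.

  No clock appears in the formal proof: both formulas are stated for an arbitrary state
  of the procedure and verified by induction. The induction step is the fundamental theorem of
  calculus applied to such a product, because differentiating one factor amounts to cutting the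
  corresponding vertex once (\<open>surv_integral_step\<close>). This gives \<open>expectation_remaining_cuts\<close> and
  \<open>second_moment_remaining_cuts\<close>, which hold for every finite rooted tree.

  For the random recursive tree, suitable generating functions of ancestral lines are, on average,
  multiplied by an explicit factor each time a vertex is attached. With \<open>L = ln n\<close> this yields
  \<open>E K \<ge> n \<integral> q exp (- L (1 - q))\<close> and \<open>E (K (K + 1)) \<le> n (n + 1) (\<integral> h exp (- L (1 - q)))\<^sup>2\<close> with
  \<open>h(x) \<rightarrow> 1\<close> as \<open>x \<rightarrow> 0\<close>. As \<open>1 - q(x)\<close> is asymptotic to \<open>x\<^sup>k / k!\<close> at \<open>0\<close>, Laplace's method
  (\<open>laplace_method\<close>) shows that both integrals are asymptotic to \<open>c L\<^bsup>- 1/k\<^esup>\<close>, where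
  \<open>c = \<integral> exp (- x\<^sup>k / k!) dx\<close> over the positive half-line, that is, \<open>c = (k!)\<^bsup>1/k\<^esup> \<Gamma>(1 + 1/k)\<close>.
  So the first two moments of the rescaled cut number converge to \<open>c\<close> and \<open>c\<^sup>2\<close>, and Chebyshev's inequality finishes the proof.
\<close>

section \<open>The tail of a Poisson clock\<close>

text \<open>
  The probability that a Poisson clock of rate \<open>1\<close> has rung fewer than \<open>m\<close> times by time \<open>x\<close>, i.e.
  that a vertex which can take \<open>m\<close> more cuts is still present.
\<close>

definition surv :: "nat \<Rightarrow> real \<Rightarrow> real" where
  "surv m x = exp (- x) * (\<Sum>i<m. x ^ i / fact i)"

lemma surv_0_left [simp]: "surv 0 x = 0"
  by (simp add: surv_def)

lemma surv_0_right: "surv m 0 = (if m = 0 then 0 else 1)"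
  by (cases m) (auto simp: surv_def lessThan_Suc_eq_insert_0 sum.reindex)

lemma surv_Suc: "surv (Suc m) x = surv m x + exp (- x) * (x ^ m / fact m)"
  by (simp add: surv_def algebra_simps)

lemma surv_nonneg [simp]: "x \<ge> 0 \<Longrightarrow> surv m x \<ge> 0"
  by (auto simp: surv_def intro!: mult_nonneg_nonneg sum_nonneg)

lemma surv_pos: "x \<ge> 0 \<Longrightarrow> m > 0 \<Longrightarrow> surv m x > 0"
  by (cases m) (auto simp: surv_def sum.lessThan_Suc_shift simp del: sum.lessThan_Suc
      intro!: mult_pos_pos add_pos_nonneg sum_nonneg)

lemma surv_pred_le: "x \<ge> 0 \<Longrightarrow> surv (m - 1) x \<le> surv m x"
  by (cases m) (auto simp: surv_Suc)

text \<open>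
  The identity that drives everything: differentiating in time is the same as taking away one
  of the remaining cuts. For \<open>m = 0\<close> it reads \<open>0 = 0\<close> since \<open>0 - 1 = 0\<close> in the natural numbers.
\<close>

lemma surv_deriv: "(surv m has_real_derivative (surv (m - 1) x - surv m x)) (at x)"
proof (induction m)
  case 0
  show ?case by (simp add: surv_def[abs_def])
next
  case (Suc m)
  have eq: "surv (Suc m) = (\<lambda>x. surv m x + exp (- x) * (x ^ m / fact m))"
    by (rule ext) (rule surv_Suc)
  have "((\<lambda>x. surv m x + exp (- x) * (x ^ m / fact m)) has_real_derivative
      (surv (m - 1) x - surv m x) + (exp (- x) * (real m * x ^ (m - 1) / fact m) - exp (- x) * (x ^ m / fact m))) (at x)"
    by (intro DERIV_add Suc) (auto intro!: derivative_eq_intros simp: diff_divide_distrib algebra_simps)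
  moreover have "(surv (m - 1) x - surv m x) + (exp (- x) * (real m * x ^ (m - 1) / fact m) - exp (- x) * (x ^ m / fact m))
     = surv (Suc m - 1) x - surv (Suc m) x"
  proof (cases m)
    case (Suc n)
    have "real (Suc n) * x ^ n / fact (Suc n) = x ^ n / fact n"
      by (simp only: fact_Suc of_nat_mult of_nat_fact) (simp del: of_nat_Suc)
    then show ?thesis
      unfolding Suc by (simp add: surv_Suc del: fact_Suc of_nat_Suc)
  qed (simp add: surv_Suc)
  ultimately show ?case unfolding eq by (rule DERIV_cong)
qed

lemma isCont_surv: "isCont (surv m) x"
  using surv_deriv DERIV_isCont by blast

lemma surv_measurable [measurable]: "surv m \<in> borel_measurable borel"
  by (intro borel_measurable_continuous_onI continuous_at_imp_continuous_on ballI isCont_surv)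

lemma surv_antimono:
  assumes "0 \<le> x" "x \<le> y"
  shows "surv m y \<le> surv m x"
  by (rule DERIV_nonpos_imp_nonincreasing[OF assms(2)])
     (use assms surv_deriv surv_pred_le in \<open>metis diff_le_0_iff_le order.trans\<close>)

lemma surv_le_1: "x \<ge> 0 \<Longrightarrow> surv m x \<le> 1"
  using surv_antimono[of 0 x m] by (auto simp: surv_0_right split: if_splits)

text \<open>
  Splitting \<open>x\<^sup>i = 2\<^sup>i (x/2)\<^sup>i\<close> trades the polynomial factor for half of the exponent. The bound
  makes \<open>surv m\<close> and its square root integrable.
\<close>

lemma surv_le_exp:
  assumes "x \<ge> 0"
  shows "surv m x \<le> 2 ^ m * exp (- (x / 2))"
proof -
  have "(\<Sum>i<m. x ^ i / fact i) \<le> (\<Sum>i<m. 2 ^ m * ((x / 2) ^ i / fact i))"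
  proof (rule sum_mono)
    fix i assume "i \<in> {..<m}"
    then have "x ^ i / fact i = 2 ^ i * ((x / 2) ^ i / fact i)" "(2::real) ^ i \<le> 2 ^ m"
      by (auto simp: power_divide intro!: power_increasing)
    moreover have "0 \<le> (x / 2) ^ i / fact i"
      using assms by simp
    ultimately show "x ^ i / fact i \<le> 2 ^ m * ((x / 2) ^ i / fact i)"
      by (metis mult_right_mono)
  qed
  also have "\<dots> = 2 ^ m * (\<Sum>i<m. (x / 2) ^ i / fact i)"
    by (simp add: sum_distrib_left)
  also have "(\<Sum>i<m. (x / 2) ^ i / fact i) \<le> exp (x / 2)"
  proof -
    have "surv m (x / 2) \<le> 1" using assms by (intro surv_le_1) auto
    then show ?thesis by (simp add: surv_def exp_minus field_simps)
  qed
  finally have "surv m x \<le> exp (- x) * (2 ^ m * exp (x / 2))"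
    by (simp add: surv_def)
  also have "\<dots> = 2 ^ m * exp (- (x / 2))"
    by (simp flip: exp_add)
  finally show ?thesis .
qed

lemma surv_tendsto_0: "(surv m \<longlongrightarrow> 0) at_top"
proof (rule tendsto_sandwich)
  show "\<forall>\<^sub>F x in at_top. 0 \<le> surv m x"
    using eventually_ge_at_top[of 0] by eventually_elim simp
  show "\<forall>\<^sub>F x in at_top. surv m x \<le> 2 ^ m * exp (- (x / 2))"
    using eventually_ge_at_top[of 0] by eventually_elim (rule surv_le_exp)
  show "((\<lambda>x. 2 ^ m * exp (- (x / 2))) \<longlongrightarrow> (0::real)) at_top"
    by real_asymp
qed auto

text \<open>
  The Poisson tail at small times, with the constant \<open>1 / m!\<close> that ends up in the limit. The upper
  bound is the Lagrange remainder of the exponential series; the lower one keeps only the term of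
  exactly \<open>m\<close> rings.
\<close>

lemma one_minus_surv_upper: "x \<ge> 0 \<Longrightarrow> 1 - surv m x \<le> x ^ m / fact m"
proof -
  assume x: "x \<ge> 0"
  obtain t where t: "\<bar>t\<bar> \<le> \<bar>x\<bar>" "exp x = (\<Sum>i<m. x ^ i / fact i) + exp t / fact m * x ^ m"
    using Maclaurin_exp_le by blast
  have "1 - surv m x = exp (- x) * (exp x - (\<Sum>i<m. x ^ i / fact i))"
    by (simp add: surv_def right_diff_distrib flip: exp_add)
  also have "\<dots> = exp (t - x) * (x ^ m / fact m)"
    unfolding t(2) by (simp add: exp_diff exp_minus field_simps)
  also have "\<dots> \<le> 1 * (x ^ m / fact m)"
    using t x by (intro mult_right_mono) auto
  finally show ?thesis by simp
qed

lemma one_minus_surv_lower: "x \<ge> 0 \<Longrightarrow> exp (- x) * (x ^ m / fact m) \<le> 1 - surv m x"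
  using surv_le_1[of x "Suc m"] by (simp add: surv_Suc)

section \<open>Survival of a set of vertices and its integral over time\<close>

text \<open>
  The probability that every \<open>u \<in> S\<close>, having received \<open>c u\<close> cuts at time \<open>0\<close>, is still present at
  time \<open>x + d u\<close>. The individual delays \<open>d\<close> are what the second moment needs: there two vertices are
  observed at different times.
\<close>

definition path_surv :: "nat \<Rightarrow> ('v \<Rightarrow> nat) \<Rightarrow> 'v set \<Rightarrow> ('v \<Rightarrow> real) \<Rightarrow> real \<Rightarrow> real" where
  "path_surv k c S d x = (\<Prod>u\<in>S. surv (k - c u) (x + d u))"

definition surv_integral :: "nat \<Rightarrow> ('v \<Rightarrow> nat) \<Rightarrow> 'v set \<Rightarrow> ('v \<Rightarrow> real) \<Rightarrow> ennreal" where
  "surv_integral k c S d = (\<integral>\<^sup>+x\<in>{0..}. ennreal (path_surv k c S d x) \<partial>lborel)"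

lemma path_surv_measurable [measurable]: "path_surv k c S d \<in> borel_measurable borel"
  unfolding path_surv_def[abs_def] by measurable

lemma path_surv_bounds:
  assumes "x \<ge> 0" "\<And>u. u \<in> S \<Longrightarrow> d u \<ge> 0"
  shows "0 \<le> path_surv k c S d x" "path_surv k c S d x \<le> 1"
  using assms by (auto simp: path_surv_def surv_le_1 intro!: prod_nonneg prod_le_1)

text \<open>
  Truncated subtraction makes the tail of a removed vertex vanish, so products over sets
  containing a removed vertex disappear without a case distinction on the state.
\<close>

lemma path_surv_eq_0:
  assumes "finite S" "u \<in> S" "k \<le> c u"
  shows "path_surv k c S d x = 0"
  using assms by (auto simp: path_surv_def intro!: bexI[of _ u])

lemma path_surv_cut:
  assumes "finite S" "u \<in> S"
  shows "path_surv k (c(u := Suc (c u))) S d x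
           = surv (k - c u - 1) (x + d u) * path_surv k c (S - {u}) d x"
  using assms by (auto simp: path_surv_def prod.remove[of S u] intro!: prod.cong)

lemma path_surv_deriv:
  assumes "finite S"
  shows "(path_surv k c S d has_real_derivative
           (\<Sum>u\<in>S. path_surv k (c(u := Suc (c u))) S d x - path_surv k c S d x)) (at x)"
proof -
  have "((\<lambda>x. \<Prod>u\<in>S. surv (k - c u) (x + d u)) has_real_derivative
      (\<Sum>u\<in>S. (surv (k - c u - 1) (x + d u) - surv (k - c u) (x + d u))
         * (\<Prod>v\<in>S - {u}. surv (k - c v) (x + d v)))) (at x)"
  proof (rule has_field_derivative_prod)
    fix u
    show "((\<lambda>x. surv (k - c u) (x + d u)) has_real_derivative
        surv (k - c u - 1) (x + d u) - surv (k - c u) (x + d u)) (at x)"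
      using surv_deriv[of "k - c u" "x + d u"] by (simp add: DERIV_shift)
  qed
  also have "(\<Sum>u\<in>S. (surv (k - c u - 1) (x + d u) - surv (k - c u) (x + d u))
         * (\<Prod>v\<in>S - {u}. surv (k - c v) (x + d v)))
      = (\<Sum>u\<in>S. path_surv k (c(u := Suc (c u))) S d x - path_surv k c S d x)"
  proof (rule sum.cong)
    fix u assume u: "u \<in> S"
    have "path_surv k c S d x = surv (k - c u) (x + d u) * path_surv k c (S - {u}) d x"
      using assms u by (simp add: path_surv_def prod.remove[of S u])
    then show "(surv (k - c u - 1) (x + d u) - surv (k - c u) (x + d u))
         * (\<Prod>v\<in>S - {u}. surv (k - c v) (x + d v))
       = path_surv k (c(u := Suc (c u))) S d x - path_surv k c S d x"
      using path_surv_cut[OF assms u, of k c d x] by (simp add: path_surv_def left_diff_distrib)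
  qed simp
  finally show ?thesis by (simp add: path_surv_def[abs_def])
qed

lemma path_surv_cut_le:
  assumes "finite S" "u \<in> S" "x \<ge> 0" "\<And>u. u \<in> S \<Longrightarrow> d u \<ge> 0"
  shows "path_surv k (c(u := Suc (c u))) S d x \<le> path_surv k c S d x"
proof -
  have "path_surv k c S d x = surv (k - c u) (x + d u) * path_surv k c (S - {u}) d x"
    using assms by (simp add: path_surv_def prod.remove[of S u])
  moreover have "0 \<le> path_surv k c (S - {u}) d x"
    using assms by (intro path_surv_bounds) auto
  moreover have "surv (k - c u - 1) (x + d u) \<le> surv (k - c u) (x + d u)"
    using assms by (intro surv_pred_le) auto
  ultimately show ?thesis
    by (simp only: path_surv_cut[OF assms(1,2)] mult_right_mono)
qed

lemma path_surv_tendsto_0: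
  assumes "finite S" "v \<in> S" "\<And>u. u \<in> S \<Longrightarrow> d u \<ge> 0"
  shows "(path_surv k c S d \<longlongrightarrow> 0) at_top"
proof (rule tendsto_sandwich)
  show "\<forall>\<^sub>F x in at_top. 0 \<le> path_surv k c S d x"
    using eventually_ge_at_top[of 0] by eventually_elim (use assms in \<open>intro path_surv_bounds\<close>)
  show "\<forall>\<^sub>F x in at_top. path_surv k c S d x \<le> surv (k - c v) x"
    using eventually_ge_at_top[of 0]
  proof eventually_elim
    case (elim x)
    have "path_surv k c S d x = surv (k - c v) (x + d v) * path_surv k c (S - {v}) d x"
      using assms by (simp add: path_surv_def prod.remove[of S v])
    also have "\<dots> \<le> surv (k - c v) x * 1"
      using assms elim by (intro mult_mono surv_antimono path_surv_bounds) auto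
    finally show ?case by simp
  qed
qed (auto intro: surv_tendsto_0)

text \<open>
  Integrating the derivative of \<open>path_surv\<close> over the half-line: the product tends to \<open>0\<close>, so the
  integral of the losses equals the value at time \<open>0\<close>, and each loss is the difference between not
  cutting and cutting one vertex of \<open>S\<close>. The identity is written additively because the integrals
  are extended nonnegative reals.
\<close>

lemma surv_integral_step:
  fixes c :: "'v \<Rightarrow> nat"
  assumes S: "finite S" "S \<noteq> {}" and d: "\<And>u. u \<in> S \<Longrightarrow> d u \<ge> 0"
  shows "of_nat (card S) * surv_integral k c S d
           = ennreal (\<Prod>u\<in>S. surv (k - c u) (d u))
             + (\<Sum>u\<in>S. surv_integral k (c(u := Suc (c u))) S d)"
proof -
  let ?P = "path_surv k c S d" and ?Q = "\<lambda>u. path_surv k (c(u := Suc (c u))) S d"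
  define f where "f x = (\<Sum>u\<in>S. ?P x - ?Q u x)" for x
  have [measurable]: "f \<in> borel_measurable borel"
    unfolding f_def[abs_def] by measurable
  have f_nonneg: "f x \<ge> 0" if "x \<ge> 0" for x
    unfolding f_def
  proof (rule sum_nonneg)
    fix u assume "u \<in> S"
    then show "0 \<le> ?P x - ?Q u x"
      using path_surv_cut_le[where k = k and c = c and d = d, OF S(1) _ that d] by simp
  qed
  obtain v where v: "v \<in> S" using S by auto
  have "(\<integral>\<^sup>+x. ennreal (f x) * indicator {0..} x \<partial>lborel) = ennreal (- 0 - - ?P 0)"
  proof (rule nn_integral_FTC_atLeast)
    fix x :: real
    have "((\<lambda>x. - ?P x) has_real_derivative - (\<Sum>u\<in>S. ?Q u x - ?P x)) (at x)"
      by (intro DERIV_minus path_surv_deriv S)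
    then show "((\<lambda>x. - ?P x) has_real_derivative f x) (at x)"
      by (simp add: f_def flip: sum_negf)
  next
    show "((\<lambda>x. - ?P x) \<longlongrightarrow> - 0) at_top"
      by (rule tendsto_minus) (rule path_surv_tendsto_0[OF S(1) v d])
  qed (auto intro: f_nonneg)
  then have 1: "(\<integral>\<^sup>+x. ennreal (f x) * indicator {0..} x \<partial>lborel) = ennreal (?P 0)"
    by simp
  have "of_nat (card S) * surv_integral k c S d
      = (\<integral>\<^sup>+x. of_nat (card S) * (ennreal (?P x) * indicator {0..} x) \<partial>lborel)"
    unfolding surv_integral_def by (subst nn_integral_cmult) auto
  also have "\<dots> = (\<integral>\<^sup>+x. ennreal (f x) * indicator {0..} x
                       + (\<Sum>u\<in>S. ennreal (?Q u x) * indicator {0..} x) \<partial>lborel)"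
  proof (rule nn_integral_cong)
    fix x :: real
    have "of_nat (card S) * ennreal (?P x) = ennreal (f x) + (\<Sum>u\<in>S. ennreal (?Q u x))" if x: "x \<ge> 0"
    proof -
      have Q: "\<And>u. 0 \<le> ?Q u x" "0 \<le> ?P x" using x d by (auto intro!: path_surv_bounds)
      have "real (card S) * ?P x = f x + (\<Sum>u\<in>S. ?Q u x)"
        by (simp add: f_def sum_subtractf)
      then have "ennreal (real (card S) * ?P x) = ennreal (f x + (\<Sum>u\<in>S. ?Q u x))"
        by simp
      then show ?thesis
        using Q f_nonneg[OF x]
        by (simp add: ennreal_mult ennreal_plus sum_nonneg sum_ennreal ennreal_of_nat_eq_real_of_nat)
    qed
    then show "of_nat (card S) * (ennreal (?P x) * indicator {0..} x)
        = ennreal (f x) * indicator {0..} x + (\<Sum>u\<in>S. ennreal (?Q u x) * indicator {0..} x)"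
      by (auto simp: indicator_def)
  qed
  also have "\<dots> = ennreal (?P 0) + (\<Sum>u\<in>S. surv_integral k (c(u := Suc (c u))) S d)"
    by (subst nn_integral_add) (auto simp: 1 surv_integral_def nn_integral_sum)
  also have "?P 0 = (\<Prod>u\<in>S. surv (k - c u) (d u))"
    by (simp add: path_surv_def)
  finally show ?thesis .
qed

lemma surv_integral_eq_0:
  assumes "finite S" "u \<in> S" "k \<le> c u"
  shows "surv_integral k c S d = 0"
  using path_surv_eq_0[where k = k and c = c, OF assms] by (simp add: surv_integral_def)

lemma surv_integral_cong:
  assumes "\<And>u. u \<in> S \<Longrightarrow> c u = c' u"
  shows "surv_integral k c S d = surv_integral k c' S d"
  using assms by (simp add: surv_integral_def path_surv_def cong: prod.cong)

section \<open>The procedure on a tree\<close>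

text \<open>
  The recursion equation is conditional on a test that rewriting can establish again for the
  recursive call, so as a rewrite rule it would unfold without end.
\<close>

declare remaining_cuts.simps [simp del]

text \<open>
  The ancestral line of \<open>v\<close>, including \<open>v\<close> itself.
\<close>

definition ancestors :: "'v rooted_graph \<Rightarrow> 'v \<Rightarrow> 'v set" where
  "ancestors T v = {u. (u, v) \<in> (edges T)\<^sup>*}"

definition arborescence :: "'v rooted_graph \<Rightarrow> bool" where
  "arborescence T \<longleftrightarrow> finite (verts T) \<and> root_vertex T \<in> verts T \<and> edges T \<subseteq> verts T \<times> verts T
     \<and> (\<forall>a. (a, root_vertex T) \<notin> edges T) \<and> single_valued ((edges T)\<inverse>)
     \<and> (\<forall>v\<in>verts T. (root_vertex T, v) \<in> (edges T)\<^sup>*)"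

text \<open>
  During the procedure the current graph is determined by the numbers of cuts: it is the original
  tree restricted to the vertices with fewer than \<open>k\<close> cuts. This lets the
  induction run over \<open>c\<close> alone.
\<close>

definition alive_graph :: "nat \<Rightarrow> 'v rooted_graph \<Rightarrow> ('v \<Rightarrow> nat) \<Rightarrow> 'v rooted_graph" where
  "alive_graph k T c = T\<lparr>verts := {v \<in> verts T. c v < k},
                          edges := {(a, b) \<in> edges T. c a < k \<and> c b < k}\<rparr>"

definition alive :: "nat \<Rightarrow> 'v rooted_graph \<Rightarrow> ('v \<Rightarrow> nat) \<Rightarrow> 'v set" where
  "alive k T c = {v \<in> verts T. \<forall>u\<in>ancestors T v. c u < k}"

lemma self_in_ancestors [simp]: "v \<in> ancestors T v"
  by (simp add: ancestors_def)

lemma ancestors_mono: "u \<in> ancestors T v \<Longrightarrow> ancestors T u \<subseteq> ancestors T v"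
  by (auto simp: ancestors_def)

lemma ancestors_subset_verts:
  assumes "arborescence T" "v \<in> verts T"
  shows "ancestors T v \<subseteq> verts T"
proof
  fix u assume "u \<in> ancestors T v"
  then have "(u, v) \<in> (edges T)\<^sup>*" by (simp add: ancestors_def)
  then show "u \<in> verts T"
    by (cases rule: converse_rtranclE) (use assms in \<open>auto simp: arborescence_def\<close>)
qed

lemma finite_ancestors: "arborescence T \<Longrightarrow> v \<in> verts T \<Longrightarrow> finite (ancestors T v)"
  using ancestors_subset_verts[of T v] by (auto simp: arborescence_def intro: finite_subset)

lemma ancestors_root:
  assumes "arborescence T"
  shows "ancestors T (root_vertex T) = {root_vertex T}"
proof -
  have "u = root_vertex T" if "(u, root_vertex T) \<in> (edges T)\<^sup>*" for u
    using that by (cases rule: rtranclE) (use assms in \<open>auto simp: arborescence_def\<close>)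
  then show ?thesis by (auto simp: ancestors_def)
qed

lemma root_in_ancestors:
  "arborescence T \<Longrightarrow> v \<in> verts T \<Longrightarrow> root_vertex T \<in> ancestors T v"
  by (auto simp: ancestors_def arborescence_def)

lemma ancestors_edge:
  assumes "arborescence T" "(a, b) \<in> edges T"
  shows "ancestors T b = insert b (ancestors T a)"
proof -
  have parent: "a' = a" if "(a', b) \<in> edges T" for a'
    using assms that unfolding arborescence_def single_valued_def by blast
  have "u = b \<or> (u, a) \<in> (edges T)\<^sup>*" if "(u, b) \<in> (edges T)\<^sup>*" for u
    using that by (cases rule: rtranclE) (auto dest: parent)
  then show ?thesis
    using assms(2) by (auto simp: ancestors_def intro: rtrancl_into_rtrancl)
qed

text \<open>
  Along an edge between two present vertices the ancestral line changes only by the lower end, so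
  having an intact ancestral line propagates both up and down; conversely an intact line is a
  path to the root. This turns undirected connectivity into a condition on ancestors.
\<close>

lemma root_component_alive_graph:
  assumes T: "arborescence T" and root: "c (root_vertex T) < k"
  shows "root_component (alive_graph k T c) = alive k T c"
proof (intro equalityI subsetI)
  define E where "E = {(a, b) \<in> edges T. c a < k \<and> c b < k}"
  have E: "edges (alive_graph k T c) = E"
    and V: "verts (alive_graph k T c) = {v \<in> verts T. c v < k}"
    and R: "root_vertex (alive_graph k T c) = root_vertex T"
    by (simp_all add: alive_graph_def E_def)
  {
    fix v assume "v \<in> root_component (alive_graph k T c)"
    then have v: "v \<in> verts T" and "(root_vertex T, v) \<in> (E \<union> E\<inverse>)\<^sup>*"
      by (auto simp: root_component_def E V R)
    from this(2) have "\<forall>u\<in>ancestors T v. c u < k"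
    proof (induction rule: rtrancl_induct)
      case base
      then show ?case using root by (simp add: ancestors_root[OF T])
    next
      case (step a b)
      then have "(a, b) \<in> edges T \<and> c b < k \<or> (b, a) \<in> edges T"
        by (auto simp: E_def)
      then show ?case
      proof
        assume "(a, b) \<in> edges T \<and> c b < k"
        with step.IH show ?thesis by (auto simp: ancestors_edge[OF T, of a b])
      next
        assume "(b, a) \<in> edges T"
        with step.IH show ?thesis by (auto simp: ancestors_edge[OF T, of b a])
      qed
    qed
    with v show "v \<in> alive k T c" by (simp add: alive_def)
  next
    fix v assume "v \<in> alive k T c"
    then have v: "v \<in> verts T" and alive: "\<forall>u\<in>ancestors T v. c u < k"
      by (auto simp: alive_def)
    have "(root_vertex T, v) \<in> (edges T)\<^sup>*"
      using T v by (simp add: arborescence_def)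
    then have "(\<forall>u\<in>ancestors T v. c u < k) \<longrightarrow> (root_vertex T, v) \<in> (E \<union> E\<inverse>)\<^sup>*"
    proof (induction rule: rtrancl_induct)
      case (step a b)
      show ?case
      proof
        assume *: "\<forall>u\<in>ancestors T b. c u < k"
        have "(a, b) \<in> E"
          using * step.hyps(2) ancestors_edge[OF T step.hyps(2)] self_in_ancestors[of a T]
          by (auto simp: E_def simp del: self_in_ancestors)
        moreover have "(root_vertex T, a) \<in> (E \<union> E\<inverse>)\<^sup>*"
          using * step.IH ancestors_edge[OF T step.hyps(2)] by auto
        ultimately show "(root_vertex T, b) \<in> (E \<union> E\<inverse>)\<^sup>*"
          by (auto intro: rtrancl_into_rtrancl)
      qed
    qed auto
    with v alive show "v \<in> root_component (alive_graph k T c)"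
      by (auto simp: root_component_def E V R)
  }
qed

lemma cut_alive_graph:
  assumes "v \<in> alive k T c"
  shows "cut_vertex k v (alive_graph k T c, c)
           = (alive_graph k T (c(v := Suc (c v))), c(v := Suc (c v)))"
proof -
  have "c v < k" using assms by (auto simp: alive_def)
  then show ?thesis
    by (auto simp: cut_vertex_def alive_graph_def remove_vertex_def split: if_splits
          intro!: rooted_graph.equality)
qed

lemma root_in_alive:
  "arborescence T \<Longrightarrow> root_vertex T \<in> alive k T c \<longleftrightarrow> c (root_vertex T) < k"
  by (auto simp: alive_def ancestors_root) (auto simp: arborescence_def)

lemma finite_alive: "arborescence T \<Longrightarrow> finite (alive k T c)"
  by (auto simp: alive_def arborescence_def)

lemma nn_integral_remaining_cuts:
  assumes T: "arborescence T" and root: "c (root_vertex T) < k"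
  shows "of_nat (card (alive k T c)) * (\<integral>\<^sup>+m. f m \<partial>remaining_cuts k (alive_graph k T c, c))
       = (\<Sum>u\<in>alive k T c.
            \<integral>\<^sup>+m. f (Suc m) \<partial>remaining_cuts k (alive_graph k T (c(u := Suc (c u))), c(u := Suc (c u))))"
    (is "of_nat ?n * _ = (\<Sum>u\<in>_. ?I u)")
proof -
  have ne: "alive k T c \<noteq> {}" "finite (alive k T c)"
    using root_in_alive[OF T, of k c] root finite_alive[OF T] by auto
  have "finite (verts (alive_graph k T c))" "root_vertex (alive_graph k T c) \<in> verts (alive_graph k T c)"
    using T root by (auto simp: alive_graph_def arborescence_def)
  then have "remaining_cuts k (alive_graph k T c, c)
      = bind_pmf (pmf_of_set (alive k T c))
          (\<lambda>v. map_pmf Suc (remaining_cuts k (cut_vertex k v (alive_graph k T c, c))))"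
    by (subst remaining_cuts.simps) (simp add: root_component_alive_graph[where c = c, OF T root])
  then have "(\<integral>\<^sup>+m. f m \<partial>remaining_cuts k (alive_graph k T c, c))
      = (\<Sum>u\<in>alive k T c. \<integral>\<^sup>+m. f (Suc m) \<partial>remaining_cuts k (cut_vertex k u (alive_graph k T c, c)))
          / of_nat ?n"
    by (simp add: nn_integral_pmf_of_set[OF ne])
  also have "(\<Sum>u\<in>alive k T c. \<integral>\<^sup>+m. f (Suc m) \<partial>remaining_cuts k (cut_vertex k u (alive_graph k T c, c)))
      = (\<Sum>u\<in>alive k T c. ?I u)"
    by (intro sum.cong refl) (simp add: cut_alive_graph)
  finally have "(\<integral>\<^sup>+m. f m \<partial>remaining_cuts k (alive_graph k T c, c)) = (\<Sum>u\<in>alive k T c. ?I u) / of_nat ?n" .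
  moreover have "of_nat ?n * (x / of_nat ?n) = x" for x :: ennreal
  proof -
    have "of_nat ?n * (x / of_nat ?n) = x * (of_nat ?n / of_nat ?n)"
      by (simp add: ennreal_times_divide mult.commute)
    also have "of_nat ?n / of_nat ?n = (1 :: ennreal)"
      using ne by (intro ennreal_divide_self) (auto simp: of_nat_less_top)
    finally show ?thesis by simp
  qed
  ultimately show ?thesis by simp
qed

lemma remaining_cuts_root_dead:
  "k \<le> c (root_vertex T) \<Longrightarrow> remaining_cuts k (alive_graph k T c, c) = return_pmf 0"
  by (subst remaining_cuts.simps) (simp add: alive_graph_def)

text \<open>
  The one-step recursion of the procedure for a set closed under ancestors. If such a set contains
  a removed vertex, all terms vanish; otherwise it lies inside the root component, and cutting a
  vertex of that component outside \<open>S\<close> changes nothing.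
\<close>

lemma surv_integral_alive_step:
  assumes T: "arborescence T"
    and S: "S \<subseteq> verts T" "S \<noteq> {}" "\<And>u. u \<in> S \<Longrightarrow> ancestors T u \<subseteq> S"
    and d: "\<And>u. u \<in> S \<Longrightarrow> d u \<ge> 0"
  shows "of_nat (card (alive k T c)) * surv_integral k c S d
           = ennreal (\<Prod>u\<in>S. surv (k - c u) (d u))
             + (\<Sum>u\<in>alive k T c. surv_integral k (c(u := Suc (c u))) S d)"
proof -
  have fin: "finite S" using T S(1) by (auto simp: arborescence_def intro: finite_subset)
  show ?thesis
  proof (cases "\<exists>u\<in>S. k \<le> c u")
    case True
    then obtain u where u: "u \<in> S" "k \<le> c u" by auto
    have "(\<Prod>u\<in>S. surv (k - c u) (d u)) = 0"
      using fin u by (auto intro!: bexI[of _ u])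
    moreover have "surv_integral k (c(v := Suc (c v))) S d = 0" for v
      by (rule surv_integral_eq_0[OF fin u(1)]) (use u in auto)
    ultimately show ?thesis
      by (simp add: surv_integral_eq_0[where c = c, OF fin u])
  next
    case False
    then have sub: "S \<subseteq> alive k T c"
      using S by (fastforce simp: alive_def)
    let ?C = "alive k T c"
    have "(\<Sum>u\<in>?C. surv_integral k (c(u := Suc (c u))) S d)
        = (\<Sum>u\<in>S. surv_integral k (c(u := Suc (c u))) S d) + (\<Sum>u\<in>?C - S. surv_integral k c S d)"
    proof -
      have "(\<Sum>u\<in>?C - S. surv_integral k (c(u := Suc (c u))) S d) = (\<Sum>u\<in>?C - S. surv_integral k c S d)"
        by (intro sum.cong surv_integral_cong) auto
      then show ?thesis
        using sum.subset_diff[OF sub finite_alive[OF T], of "\<lambda>u. surv_integral k (c(u := Suc (c u))) S d"]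
        by (simp add: add.commute)
    qed
    moreover have "card ?C = card S + card (?C - S)"
      using sub finite_alive[OF T] by (metis card_Diff_subset card_mono fin le_add_diff_inverse)
    ultimately show ?thesis
      using surv_integral_step[where c = c and k = k and d = d, OF fin S(2) d]
      by (simp add: distrib_right add.assoc)
  qed
qed

lemma surv_diff_0_right: "surv (k - c) 0 = (if c < k then 1 else 0)"
  by (simp add: surv_0_right)

text \<open>
  The integral over time of the expected size of the root component.
\<close>

definition mean_cuts :: "nat \<Rightarrow> 'v rooted_graph \<Rightarrow> ('v \<Rightarrow> nat) \<Rightarrow> ennreal" where
  "mean_cuts k T c = (\<Sum>v\<in>verts T. surv_integral k c (ancestors T v) (\<lambda>_. 0))"

lemma mean_cuts_step:
  assumes T: "arborescence T"
  shows "of_nat (card (alive k T c)) * mean_cuts k T c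
           = of_nat (card (alive k T c)) + (\<Sum>u\<in>alive k T c. mean_cuts k T (c(u := Suc (c u))))"
proof -
  let ?C = "alive k T c"
  have fin: "finite (verts T)" using T by (simp add: arborescence_def)
  have 0: "(\<Prod>u\<in>ancestors T v. surv (k - c u) 0) = (if v \<in> ?C then 1 else 0)" if "v \<in> verts T" for v
    using finite_ancestors[OF T that] that by (auto simp: alive_def surv_diff_0_right)
  have "of_nat (card ?C) * mean_cuts k T c
      = (\<Sum>v\<in>verts T. of_nat (card ?C) * surv_integral k c (ancestors T v) (\<lambda>_. 0))"
    by (simp add: mean_cuts_def sum_distrib_left)
  also have "\<dots> = (\<Sum>v\<in>verts T. (if v \<in> ?C then 1 else 0)
      + (\<Sum>u\<in>?C. surv_integral k (c(u := Suc (c u))) (ancestors T v) (\<lambda>_. 0)))"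
  proof (intro sum.cong refl)
    fix v assume v: "v \<in> verts T"
    have ne: "ancestors T v \<noteq> {}" using self_in_ancestors[of v T] by blast
    show "of_nat (card ?C) * surv_integral k c (ancestors T v) (\<lambda>_. 0)
        = (if v \<in> ?C then 1 else 0) + (\<Sum>u\<in>?C. surv_integral k (c(u := Suc (c u))) (ancestors T v) (\<lambda>_. 0))"
      using 0[OF v]
      by (subst surv_integral_alive_step[OF T ancestors_subset_verts[OF T v] ne ancestors_mono]) auto
  qed
  also have "\<dots> = (\<Sum>v\<in>verts T. if v \<in> ?C then 1 else 0)
      + (\<Sum>v\<in>verts T. \<Sum>u\<in>?C. surv_integral k (c(u := Suc (c u))) (ancestors T v) (\<lambda>_. 0))"
    by (rule sum.distrib)
  also have "(\<Sum>v\<in>verts T. if v \<in> ?C then 1 else 0) = (of_nat (card ?C) :: ennreal)"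
  proof -
    have "verts T \<inter> ?C = ?C" by (auto simp: alive_def)
    then show ?thesis using fin by (simp add: sum.If_cases)
  qed
  also have "(\<Sum>v\<in>verts T. \<Sum>u\<in>?C. surv_integral k (c(u := Suc (c u))) (ancestors T v) (\<lambda>_. 0))
      = (\<Sum>u\<in>?C. mean_cuts k T (c(u := Suc (c u))))"
    unfolding mean_cuts_def by (rule sum.swap)
  finally show ?thesis .
qed

lemma remaining_capacity_decreases:
  assumes "arborescence T" "u \<in> alive k T c"
  shows "(\<Sum>v\<in>verts T. k - (c(u := Suc (c u))) v) < (\<Sum>v\<in>verts T. k - c v)"
proof -
  have "u \<in> verts T" "c u < k" "finite (verts T)"
    using assms by (auto simp: alive_def arborescence_def)
  then show ?thesis
    by (intro sum_strict_mono_ex1) (auto intro!: bexI[of _ u])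
qed

lemma card_alive_cancel:
  assumes "arborescence T" "c (root_vertex T) < k"
    and "of_nat (card (alive k T c)) * (x :: ennreal) = of_nat (card (alive k T c)) * y"
  shows "x = y"
proof -
  have "alive k T c \<noteq> {}" "finite (alive k T c)"
    using root_in_alive[OF assms(1), of k c] assms finite_alive[OF assms(1)] by auto
  then have "of_nat (card (alive k T c)) \<noteq> (0 :: ennreal)" "of_nat (card (alive k T c)) \<noteq> (\<top> :: ennreal)"
    by auto
  with assms(3) show ?thesis
    by (simp add: ennreal_mult_cancel_left)
qed

text \<open>
  Both sides satisfy the same one-step recursion over the cut vertex. The root component is
  nonempty while the root is present, so its size can be cancelled.
\<close>

lemma expectation_remaining_cuts:
  assumes T: "arborescence T"
  shows "(\<integral>\<^sup>+m. of_nat m \<partial>remaining_cuts k (alive_graph k T c, c)) = mean_cuts k T c"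
proof (induction "\<Sum>v\<in>verts T. k - c v" arbitrary: c rule: less_induct)
  case less
  show ?case
  proof (cases "c (root_vertex T) < k")
    case False
    then have "surv_integral k c (ancestors T v) (\<lambda>_. 0) = 0" if "v \<in> verts T" for v
      using surv_integral_eq_0[OF finite_ancestors[OF T that] root_in_ancestors[OF T that]] by auto
    then show ?thesis
      using False by (simp add: remaining_cuts_root_dead mean_cuts_def)
  next
    case True
    let ?C = "alive k T c"
    have "of_nat (card ?C) * (\<integral>\<^sup>+m. of_nat m \<partial>remaining_cuts k (alive_graph k T c, c))
        = (\<Sum>u\<in>?C. 1 + mean_cuts k T (c(u := Suc (c u))))"
      unfolding nn_integral_remaining_cuts[where c = c, OF T True]
    proof (intro sum.cong refl)
      fix u assume u: "u \<in> ?C"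
      show "(\<integral>\<^sup>+m. of_nat (Suc m) \<partial>remaining_cuts k (alive_graph k T (c(u := Suc (c u))), c(u := Suc (c u))))
          = 1 + mean_cuts k T (c(u := Suc (c u)))"
        unfolding less[OF remaining_capacity_decreases[where c = c, OF T u], symmetric]
        by (simp add: nn_integral_add del: fun_upd_apply)
    qed
    also have "\<dots> = of_nat (card ?C) * mean_cuts k T c"
      by (simp add: mean_cuts_step[OF T] sum.distrib)
    finally show ?thesis
      by (rule card_alive_cancel[where c = c, OF T True])
  qed
qed

text \<open>
  Twice the integral over pairs of times \<open>x < x + r\<close> of the expected product of the sizes of the
  root component at these times. A common ancestor of \<open>v\<close> and \<open>w\<close> has to survive until the later
  time, at which \<open>w\<close> is observed. The domain of \<open>r\<close> is open so that the diagonal is left out.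
\<close>

definition second_moment_cuts :: "nat \<Rightarrow> 'v rooted_graph \<Rightarrow> ('v \<Rightarrow> nat) \<Rightarrow> ennreal" where
  "second_moment_cuts k T c = 2 * (\<integral>\<^sup>+r\<in>{0<..}. (\<Sum>w\<in>verts T. \<Sum>v\<in>verts T.
     surv_integral k c (ancestors T v \<union> ancestors T w) (\<lambda>u. if u \<in> ancestors T w then r else 0)) \<partial>lborel)"

lemma surv_integral_shift_measurable [measurable]:
  "(\<lambda>r. surv_integral k c S (\<lambda>u. if u \<in> A then r else 0)) \<in> borel_measurable borel"
  unfolding surv_integral_def path_surv_def by measurable

text \<open>
  The boundary term of the recursion belongs to time pairs \<open>(0, r)\<close>. There every \<open>v\<close> of the root
  component contributes the same amount, the survival of the line of \<open>w\<close>, which is why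
  \<open>mean_cuts\<close> appears.
\<close>

lemma second_moment_cuts_step:
  assumes T: "arborescence T"
  shows "of_nat (card (alive k T c)) * second_moment_cuts k T c
           = 2 * (of_nat (card (alive k T c)) * mean_cuts k T c)
             + (\<Sum>u\<in>alive k T c. second_moment_cuts k T (c(u := Suc (c u))))"
proof -
  let ?C = "alive k T c"
  let ?V = "verts T"
  let ?A = "ancestors T"
  let ?J = "\<lambda>c w v r. surv_integral k c (?A v \<union> ?A w) (\<lambda>u. if u \<in> ?A w then r else 0)"
  have fin: "finite ?V" using T by (simp add: arborescence_def)
  have prod: "(\<Prod>u\<in>?A v \<union> ?A w. surv (k - c u) (if u \<in> ?A w then r else 0))
      = path_surv k c (?A w) (\<lambda>_. 0) r * (if v \<in> ?C then 1 else 0)"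
    if v: "v \<in> ?V" and w: "w \<in> ?V" for v w r
  proof (cases "\<exists>u\<in>?A w. k \<le> c u")
    case True
    then obtain u where u: "u \<in> ?A w" "k \<le> c u" by auto
    have "(\<Prod>u\<in>?A v \<union> ?A w. surv (k - c u) (if u \<in> ?A w then r else 0)) = 0"
      using finite_ancestors[OF T v] finite_ancestors[OF T w] u by (auto intro!: bexI[of _ u])
    then show ?thesis
      using path_surv_eq_0[where c = c, OF finite_ancestors[OF T w] u] by simp
  next
    case False
    have "(\<Prod>u\<in>?A v \<union> ?A w. surv (k - c u) (if u \<in> ?A w then r else 0))
        = (\<Prod>u\<in>?A w. surv (k - c u) (if u \<in> ?A w then r else 0))
          * (\<Prod>u\<in>?A v - ?A w. surv (k - c u) (if u \<in> ?A w then r else 0))"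
      using finite_ancestors[OF T v] finite_ancestors[OF T w]
      by (subst prod.union_disjoint[symmetric]) (auto intro!: prod.cong)
    also have "(\<Prod>u\<in>?A v - ?A w. surv (k - c u) (if u \<in> ?A w then r else 0)) = (if v \<in> ?C then 1 else 0)"
      using finite_ancestors[OF T v] v False by (auto simp: alive_def surv_diff_0_right not_le)
    finally show ?thesis by (simp add: path_surv_def)
  qed
  have step: "of_nat (card ?C) * ?J c w v r
      = ennreal (path_surv k c (?A w) (\<lambda>_. 0) r) * (if v \<in> ?C then 1 else 0)
        + (\<Sum>u\<in>?C. ?J (c(u := Suc (c u))) w v r)"
    if v: "v \<in> ?V" and w: "w \<in> ?V" and r: "r > 0" for v w r
  proof -
    have "of_nat (card ?C) * ?J c w v r
      = ennreal (\<Prod>u\<in>?A v \<union> ?A w. surv (k - c u) (if u \<in> ?A w then r else 0))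
        + (\<Sum>u\<in>?C. ?J (c(u := Suc (c u))) w v r)"
    proof (rule surv_integral_alive_step[OF T])
      show "?A v \<union> ?A w \<subseteq> ?V"
        using ancestors_subset_verts[OF T v] ancestors_subset_verts[OF T w] by auto
      show "?A v \<union> ?A w \<noteq> {}" using self_in_ancestors[of v T] by blast
      show "?A u \<subseteq> ?A v \<union> ?A w" if "u \<in> ?A v \<union> ?A w" for u
        using that ancestors_mono[of u T] by blast
    qed (use r in auto)
    then show ?thesis unfolding prod[OF v w] by simp
  qed
  have "of_nat (card ?C) * second_moment_cuts k T c
      = 2 * (\<integral>\<^sup>+r. of_nat (card ?C) * ((\<Sum>w\<in>?V. \<Sum>v\<in>?V. ?J c w v r) * indicator {0<..} r) \<partial>lborel)"
    unfolding second_moment_cuts_def by (subst nn_integral_cmult) (auto simp: mult_ac)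
  also have "(\<integral>\<^sup>+r. of_nat (card ?C) * ((\<Sum>w\<in>?V. \<Sum>v\<in>?V. ?J c w v r) * indicator {0<..} r) \<partial>lborel)
      = (\<integral>\<^sup>+r. of_nat (card ?C) * (\<Sum>w\<in>?V. ennreal (path_surv k c (?A w) (\<lambda>_. 0) r) * indicator {0<..} r)
              + (\<Sum>u\<in>?C. (\<Sum>w\<in>?V. \<Sum>v\<in>?V. ?J (c(u := Suc (c u))) w v r) * indicator {0<..} r) \<partial>lborel)"
  proof (rule nn_integral_cong)
    fix r :: real
    show "of_nat (card ?C) * ((\<Sum>w\<in>?V. \<Sum>v\<in>?V. ?J c w v r) * indicator {0<..} r)
      = of_nat (card ?C) * (\<Sum>w\<in>?V. ennreal (path_surv k c (?A w) (\<lambda>_. 0) r) * indicator {0<..} r)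
              + (\<Sum>u\<in>?C. (\<Sum>w\<in>?V. \<Sum>v\<in>?V. ?J (c(u := Suc (c u))) w v r) * indicator {0<..} r)"
    proof (cases "r > 0")
      case True
      have "of_nat (card ?C) * (\<Sum>w\<in>?V. \<Sum>v\<in>?V. ?J c w v r)
          = (\<Sum>w\<in>?V. \<Sum>v\<in>?V. ennreal (path_surv k c (?A w) (\<lambda>_. 0) r) * (if v \<in> ?C then 1 else 0)
               + (\<Sum>u\<in>?C. ?J (c(u := Suc (c u))) w v r))"
        unfolding sum_distrib_left by (intro sum.cong refl step True)
      also have "\<dots> = (\<Sum>w\<in>?V. ennreal (path_surv k c (?A w) (\<lambda>_. 0) r) * (\<Sum>v\<in>?V. if v \<in> ?C then 1 else 0))
               + (\<Sum>w\<in>?V. \<Sum>v\<in>?V. \<Sum>u\<in>?C. ?J (c(u := Suc (c u))) w v r)"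
        by (simp only: sum.distrib sum_distrib_left)
      also have "(\<Sum>v\<in>?V. if v \<in> ?C then 1 else 0) = (of_nat (card ?C) :: ennreal)"
      proof -
        have "?V \<inter> ?C = ?C" by (auto simp: alive_def)
        then show ?thesis using fin by (simp add: sum.If_cases)
      qed
      also have "(\<Sum>w\<in>?V. \<Sum>v\<in>?V. \<Sum>u\<in>?C. ?J (c(u := Suc (c u))) w v r)
          = (\<Sum>u\<in>?C. \<Sum>w\<in>?V. \<Sum>v\<in>?V. ?J (c(u := Suc (c u))) w v r)"
      proof -
        have "(\<Sum>w\<in>?V. \<Sum>v\<in>?V. \<Sum>u\<in>?C. ?J (c(u := Suc (c u))) w v r)
            = (\<Sum>w\<in>?V. \<Sum>u\<in>?C. \<Sum>v\<in>?V. ?J (c(u := Suc (c u))) w v r)"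
          by (intro sum.cong refl sum.swap)
        also have "\<dots> = (\<Sum>u\<in>?C. \<Sum>w\<in>?V. \<Sum>v\<in>?V. ?J (c(u := Suc (c u))) w v r)"
          by (rule sum.swap)
        finally show ?thesis .
      qed
      finally show ?thesis
        using True by (simp add: sum_distrib_left mult.commute)
    qed simp
  qed
  also have "\<dots> = of_nat (card ?C) * mean_cuts k T c
      + (\<Sum>u\<in>?C. \<integral>\<^sup>+r\<in>{0<..}. (\<Sum>w\<in>?V. \<Sum>v\<in>?V. ?J (c(u := Suc (c u))) w v r) \<partial>lborel)"
  proof -
    have "(\<integral>\<^sup>+r. ennreal (path_surv k c S (\<lambda>_. 0) r) * indicator {0<..} r \<partial>lborel) = surv_integral k c S (\<lambda>_. 0)" for S
      unfolding surv_integral_def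
      by (intro nn_integral_cong_AE eventually_mono[OF AE_lborel_singleton[of 0]]) (auto simp: indicator_def)
    then show ?thesis
      by (subst nn_integral_add) (auto simp: nn_integral_cmult nn_integral_sum mean_cuts_def)
  qed
  finally show ?thesis
    by (simp add: second_moment_cuts_def distrib_left sum_distrib_left)
qed

text \<open>
  The polynomial \<open>m (m + 1)\<close> is the one for which a single cut adds twice the new
  value: \<open>(m + 1) (m + 2) = m (m + 1) + 2 (m + 1)\<close>. This matches the boundary term of
  \<open>second_moment_cuts_step\<close>; it is also the second moment of a sum of \<open>m\<close> independent standard
  exponential variables.
\<close>

lemma second_moment_remaining_cuts:
  assumes T: "arborescence T"
  shows "(\<integral>\<^sup>+m. of_nat (m * (m + 1)) \<partial>remaining_cuts k (alive_graph k T c, c)) = second_moment_cuts k T c"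
proof (induction "\<Sum>v\<in>verts T. k - c v" arbitrary: c rule: less_induct)
  case less
  show ?case
  proof (cases "c (root_vertex T) < k")
    case False
    then have "surv_integral k c (ancestors T v \<union> ancestors T w) d = 0" if "v \<in> verts T" "w \<in> verts T" for v w d
      using surv_integral_eq_0[of "ancestors T v \<union> ancestors T w" "root_vertex T" k c d]
        finite_ancestors[OF T] root_in_ancestors[OF T] that by auto
    then show ?thesis
      using False by (simp add: remaining_cuts_root_dead second_moment_cuts_def)
  next
    case True
    let ?C = "alive k T c"
    let ?R = "\<lambda>u. remaining_cuts k (alive_graph k T (c(u := Suc (c u))), c(u := Suc (c u)))"
    have "of_nat (card ?C) * (\<integral>\<^sup>+m. of_nat (m * (m + 1)) \<partial>remaining_cuts k (alive_graph k T c, c))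
        = (\<Sum>u\<in>?C. \<integral>\<^sup>+m. of_nat (m * (m + 1)) + 2 * of_nat (Suc m) \<partial>?R u)"
      unfolding nn_integral_remaining_cuts[where c = c, OF T True]
    proof (intro sum.cong refl nn_integral_cong)
      fix m :: nat
      have "Suc m * (Suc m + 1) = m * (m + 1) + 2 * Suc m" by simp
      then show "of_nat (Suc m * (Suc m + 1)) = (of_nat (m * (m + 1)) + 2 * of_nat (Suc m) :: ennreal)"
        by (simp only: of_nat_add of_nat_mult of_nat_numeral)
    qed
    also have "\<dots> = (\<Sum>u\<in>?C. second_moment_cuts k T (c(u := Suc (c u)))) + 2 * (\<Sum>u\<in>?C. \<integral>\<^sup>+m. of_nat (Suc m) \<partial>?R u)"
    proof -
      have "(\<Sum>u\<in>?C. \<integral>\<^sup>+m. of_nat (m * (m + 1)) + 2 * of_nat (Suc m) \<partial>?R u)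
          = (\<Sum>u\<in>?C. second_moment_cuts k T (c(u := Suc (c u))) + 2 * (\<integral>\<^sup>+m. of_nat (Suc m) \<partial>?R u))"
      proof (intro sum.cong refl)
        fix u assume u: "u \<in> ?C"
        show "(\<integral>\<^sup>+m. of_nat (m * (m + 1)) + 2 * of_nat (Suc m) \<partial>?R u)
            = second_moment_cuts k T (c(u := Suc (c u))) + 2 * (\<integral>\<^sup>+m. of_nat (Suc m) \<partial>?R u)"
          unfolding less[OF remaining_capacity_decreases[where c = c, OF T u], symmetric]
        proof -
          have "(\<integral>\<^sup>+m. of_nat (m * (m + 1)) + 2 * of_nat (Suc m) \<partial>?R u)
              = (\<integral>\<^sup>+m. of_nat (m * (m + 1)) \<partial>?R u) + (\<integral>\<^sup>+m. 2 * of_nat (Suc m) \<partial>?R u)"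
            by (rule nn_integral_add) simp_all
          also have "(\<integral>\<^sup>+m. 2 * of_nat (Suc m) \<partial>?R u) = 2 * (\<integral>\<^sup>+m. of_nat (Suc m) \<partial>?R u)"
            by (rule nn_integral_cmult) simp
          finally show "(\<integral>\<^sup>+m. of_nat (m * (m + 1)) + 2 * of_nat (Suc m) \<partial>?R u)
              = (\<integral>\<^sup>+m. of_nat (m * (m + 1)) \<partial>?R u) + 2 * (\<integral>\<^sup>+m. of_nat (Suc m) \<partial>?R u)" .
        qed
      qed
      then show ?thesis by (simp only: sum.distrib sum_distrib_left)
    qed
    also have "(\<Sum>u\<in>?C. \<integral>\<^sup>+m. of_nat (Suc m) \<partial>?R u) = of_nat (card ?C) * mean_cuts k T c"
      using nn_integral_remaining_cuts[where c = c and f = of_nat, OF T True]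
      by (simp only: expectation_remaining_cuts[OF T])
    also have "(\<Sum>u\<in>?C. second_moment_cuts k T (c(u := Suc (c u)))) + 2 * (of_nat (card ?C) * mean_cuts k T c)
        = of_nat (card ?C) * second_moment_cuts k T c"
      by (simp only: second_moment_cuts_step[where c = c, OF T] add.commute)
    finally show ?thesis
      by (rule card_alive_cancel[where c = c, OF T True])
  qed
qed

section \<open>Random recursive trees\<close>

lemma arborescence_attach_child:
  assumes T: "arborescence T" and u: "u \<in> verts T" and w: "w \<notin> verts T"
  shows "arborescence (attach_child u w T)"
proof -
  have mono: "(edges T)\<^sup>* \<subseteq> (insert (u, w) (edges T))\<^sup>*"
    by (intro rtrancl_mono) auto
  have reach: "(root_vertex T, v) \<in> (insert (u, w) (edges T))\<^sup>*" if "v \<in> insert w (verts T)" for v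
  proof -
    have 1: "(root_vertex T, v) \<in> (insert (u, w) (edges T))\<^sup>*" if "v \<in> verts T" for v
      using T that mono by (auto simp: arborescence_def)
    show ?thesis
      using that 1 rtrancl_into_rtrancl[OF 1[OF u], of w] by auto
  qed
  have "edges T \<subseteq> verts T \<times> verts T"
    using T by (simp add: arborescence_def)
  then have no_edge: "(a, w) \<notin> edges T" for a
    using w by auto
  have "single_valued ((insert (u, w) (edges T))\<inverse>)"
    using T no_edge unfolding arborescence_def single_valued_def by auto
  then show ?thesis
    using T u w reach by (auto simp: arborescence_def attach_child_def)
qed

lemma ancestors_attach_child_old:
  assumes T: "arborescence T" and w: "w \<notin> verts T" and v: "v \<in> verts T"
  shows "ancestors (attach_child u w T) v = ancestors T v"
proof (intro equalityI subsetI)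
  fix x assume "x \<in> ancestors (attach_child u w T) v"
  then have "(x, v) \<in> (insert (u, w) (edges T))\<^sup>*"
    by (simp add: ancestors_def attach_child_def)
  then have "v \<in> verts T \<longrightarrow> (x, v) \<in> (edges T)\<^sup>*"
  proof (induction rule: rtrancl_induct)
    case (step a b)
    show ?case
    proof
      assume "b \<in> verts T"
      with step.hyps w have "(a, b) \<in> edges T" by auto
      moreover from this have "a \<in> verts T" using T by (auto simp: arborescence_def)
      ultimately show "(x, b) \<in> (edges T)\<^sup>*"
        using step.IH by (auto intro: rtrancl_into_rtrancl)
    qed
  qed auto
  with v show "x \<in> ancestors T v" by (simp add: ancestors_def)
next
  fix x assume "x \<in> ancestors T v"
  then have "(x, v) \<in> (edges T)\<^sup>*" by (simp add: ancestors_def)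
  then have "(x, v) \<in> (insert (u, w) (edges T))\<^sup>*"
    by (rule rev_subsetD) (intro rtrancl_mono, auto)
  then show "x \<in> ancestors (attach_child u w T) v"
    by (simp add: ancestors_def attach_child_def)
qed

lemma ancestors_attach_child_new:
  assumes T: "arborescence T" and u: "u \<in> verts T" and w: "w \<notin> verts T"
  shows "ancestors (attach_child u w T) w = insert w (ancestors T u)"
proof -
  have "(u, w) \<in> edges (attach_child u w T)" by (simp add: attach_child_def)
  then show ?thesis
    using ancestors_edge[OF arborescence_attach_child[OF T u w]] ancestors_attach_child_old[OF T w u]
    by simp
qed

text \<open>
  The two sums over ancestral lines that occur in \<open>mean_cuts\<close> and \<open>second_moment_cuts\<close> when no cut has been
  made, as polynomials in the survival probabilities of a single vertex.
\<close>

definition path_gf :: "'v rooted_graph \<Rightarrow> real \<Rightarrow> real" where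
  "path_gf T y = (\<Sum>v\<in>verts T. y ^ card (ancestors T v))"

definition pair_gf :: "'v rooted_graph \<Rightarrow> real \<Rightarrow> real \<Rightarrow> real" where
  "pair_gf T a b = (\<Sum>w\<in>verts T. \<Sum>v\<in>verts T.
     b ^ card (ancestors T w) * a ^ card (ancestors T v - ancestors T w))"

lemma path_gf_attach_child:
  assumes T: "arborescence T" and u: "u \<in> verts T" and w: "w \<notin> verts T"
  shows "path_gf (attach_child u w T) y = path_gf T y + y * y ^ card (ancestors T u)"
proof -
  have fin: "finite (verts T)" using T by (simp add: arborescence_def)
  have "w \<notin> ancestors T u" "finite (ancestors T u)"
    using ancestors_subset_verts[OF T u] w finite_ancestors[OF T u] by auto
  moreover have "verts (attach_child u w T) = insert w (verts T)"
    by (simp add: attach_child_def)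
  moreover have "(\<Sum>v\<in>verts T. y ^ card (ancestors (attach_child u w T) v)) = path_gf T y"
    unfolding path_gf_def by (intro sum.cong) (simp_all add: ancestors_attach_child_old[OF T w])
  ultimately show ?thesis
    using fin w by (simp add: path_gf_def[of "attach_child u w T"] ancestors_attach_child_new[OF T u w])
qed

text \<open>
  The new vertex can be the first, the second or both members of a pair. It is never an ancestor
  of an old vertex, hence it costs one factor \<open>b\<close> if it is observed at the later time and one
  factor \<open>a\<close> otherwise.
\<close>

lemma pair_gf_attach_child:
  assumes T: "arborescence T" and u: "u \<in> verts T" and z: "z \<notin> verts T"
  shows "pair_gf (attach_child u z T) a b = pair_gf T a b
    + b * (\<Sum>v\<in>verts T. b ^ card (ancestors T u) * a ^ card (ancestors T v - ancestors T u))
    + a * (\<Sum>w\<in>verts T. b ^ card (ancestors T w) * a ^ card (ancestors T u - ancestors T w))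
    + b * b ^ card (ancestors T u)"
proof -
  let ?A = "ancestors T" and ?T = "attach_child u z T"
  have fin: "finite (verts T)" using T by (simp add: arborescence_def)
  have V: "verts ?T = insert z (verts T)" by (simp add: attach_child_def)
  have z_notin: "z \<notin> ?A v" and finA: "finite (?A v)" if "v \<in> verts T" for v
    using ancestors_subset_verts[OF T that] z finite_ancestors[OF T that] by auto
  note A = ancestors_attach_child_old[OF T z] ancestors_attach_child_new[OF T u z]
  let ?f = "\<lambda>w v. b ^ card (ancestors ?T w) * a ^ card (ancestors ?T v - ancestors ?T w)"
  have old: "(\<Sum>w\<in>verts T. \<Sum>v\<in>verts T. ?f w v) = pair_gf T a b"
    unfolding pair_gf_def by (intro sum.cong refl) (simp add: A)
  have zv: "(\<Sum>v\<in>verts T. ?f z v) = b * (\<Sum>v\<in>verts T. b ^ card (?A u) * a ^ card (?A v - ?A u))"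
    unfolding sum_distrib_left
  proof (intro sum.cong refl)
    fix v assume v: "v \<in> verts T"
    have "?A v - insert z (?A u) = ?A v - ?A u" using z_notin[OF v] by auto
    then show "?f z v = b * (b ^ card (?A u) * a ^ card (?A v - ?A u))"
      using v z_notin[OF u] finA[OF u] by (simp add: A)
  qed
  have wz: "(\<Sum>w\<in>verts T. ?f w z) = a * (\<Sum>w\<in>verts T. b ^ card (?A w) * a ^ card (?A u - ?A w))"
    unfolding sum_distrib_left
  proof (intro sum.cong refl)
    fix w assume w: "w \<in> verts T"
    have "insert z (?A u) - ?A w = insert z (?A u - ?A w)" using z_notin[OF w] by auto
    then show "?f w z = a * (b ^ card (?A w) * a ^ card (?A u - ?A w))"
      using w z_notin[OF u] finA[OF u] by (simp add: A)
  qed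
  have zz: "?f z z = b * b ^ card (?A u)"
    using z_notin[OF u] finA[OF u] by (simp add: A)
  have "pair_gf ?T a b = ?f z z + (\<Sum>v\<in>verts T. ?f z v)
      + ((\<Sum>w\<in>verts T. ?f w z) + (\<Sum>w\<in>verts T. \<Sum>v\<in>verts T. ?f w v))"
    using fin z by (simp add: pair_gf_def V sum.distrib)
  then show ?thesis unfolding old zv wz zz by simp
qed

lemma random_recursive_tree_arborescence:
  "T \<in> set_pmf (random_recursive_tree n) \<Longrightarrow> arborescence T"
proof (induction n arbitrary: T rule: random_recursive_tree.induct)
  case (3 n)
  then obtain T' u where T': "T' \<in> set_pmf (random_recursive_tree (Suc n))"
    and u: "u \<in> set_pmf (pmf_of_set (verts T'))" and T: "T = attach_child u (Suc (Suc n)) T'"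
    by auto
  have V: "verts T' = {1..Suc n}" using random_recursive_tree_verts_root[OF _ T'] by simp
  then have "u \<in> verts T'" using u by simp
  then show ?case
    unfolding T by (intro arborescence_attach_child "3.IH"[OF T']) (auto simp: V)
qed (auto simp: arborescence_def)

lemma finite_set_pmf_random_recursive_tree: "finite (set_pmf (random_recursive_tree n))"
proof (induction n rule: random_recursive_tree.induct)
  case (3 n)
  have "finite (set_pmf (pmf_of_set (verts T)))" if "T \<in> set_pmf (random_recursive_tree (Suc n))" for T
    using random_recursive_tree_verts_root[OF _ that] by simp
  with 3 show ?case by auto
qed auto

text \<open>
  A functional that the average over all attachments multiplies by a constant has an explicit
  expectation. The two instances below give all the information on the tree that is used.
\<close>

lemma nn_integral_random_recursive_tree_eigen:
  fixes g :: "nat rooted_graph \<Rightarrow> real"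
  assumes nonneg: "\<And>T. g T \<ge> 0" and y: "y \<ge> 0"
    and eigen: "\<And>m T. arborescence T \<Longrightarrow> verts T = {1..m} \<Longrightarrow> m \<ge> 1 \<Longrightarrow>
      (\<Sum>u\<in>verts T. g (attach_child u (Suc m) T)) = (real m + y) * g T"
  shows "(\<integral>\<^sup>+T. ennreal (g T) \<partial>random_recursive_tree (Suc n))
           = ennreal (g \<lparr>verts = {1}, edges = {}, root_vertex = 1\<rparr> * (\<Prod>j=1..n. 1 + y / real j))"
proof (induction n)
  case (Suc n)
  let ?m = "Suc n"
  have "(\<integral>\<^sup>+T. ennreal (g T) \<partial>random_recursive_tree (Suc ?m))
     = (\<integral>\<^sup>+T. \<integral>\<^sup>+u. ennreal (g (attach_child u (Suc ?m) T)) \<partial>pmf_of_set (verts T) \<partial>random_recursive_tree ?m)"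
    by simp
  also have "\<dots> = (\<integral>\<^sup>+T. ennreal (1 + y / real ?m) * ennreal (g T) \<partial>random_recursive_tree ?m)"
  proof (rule nn_integral_cong_AE, unfold AE_measure_pmf_iff, intro ballI)
    fix T assume T: "T \<in> set_pmf (random_recursive_tree ?m)"
    have V: "verts T = {1..?m}" using random_recursive_tree_verts_root[OF _ T] by simp
    then have ne: "verts T \<noteq> {}" "finite (verts T)" by auto
    have m1: "1 \<le> ?m" by simp
    have "(\<integral>\<^sup>+u. ennreal (g (attach_child u (Suc ?m) T)) \<partial>pmf_of_set (verts T))
        = ennreal (\<Sum>u\<in>verts T. g (attach_child u (Suc ?m) T)) / ennreal (real ?m)"
    proof -
      have "card (verts T) = ?m" by (simp add: V)
      then show ?thesis
        unfolding nn_integral_pmf_of_set[OF ne] by (simp only: sum_ennreal[OF nonneg] ennreal_of_nat_eq_real_of_nat)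
    qed
    also have "\<dots> = ennreal ((\<Sum>u\<in>verts T. g (attach_child u (Suc ?m) T)) / real ?m)"
      using nonneg by (intro divide_ennreal sum_nonneg) auto
    also have "(\<Sum>u\<in>verts T. g (attach_child u (Suc ?m) T)) / real ?m = (1 + y / real ?m) * g T"
      unfolding eigen[OF random_recursive_tree_arborescence[OF T] V m1]
      by (simp add: field_simps)
    also have "ennreal \<dots> = ennreal (1 + y / real ?m) * ennreal (g T)"
      using nonneg y by (intro ennreal_mult) auto
    finally show "(\<integral>\<^sup>+u. ennreal (g (attach_child u (Suc ?m) T)) \<partial>pmf_of_set (verts T))
        = ennreal (1 + y / real ?m) * ennreal (g T)" .
  qed
  also have "\<dots> = ennreal (1 + y / real ?m) * (\<integral>\<^sup>+T. ennreal (g T) \<partial>random_recursive_tree ?m)"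
    by (intro nn_integral_cmult) auto
  also have "\<dots> = ennreal (1 + y / real ?m) * ennreal (g \<lparr>verts = {1}, edges = {}, root_vertex = 1\<rparr> * (\<Prod>j=1..n. 1 + y / real j))"
    unfolding Suc ..
  also have "\<dots> = ennreal (g \<lparr>verts = {1}, edges = {}, root_vertex = 1\<rparr> * (\<Prod>j=1..?m. 1 + y / real j))"
    using nonneg y by (subst ennreal_mult[symmetric]) (auto intro!: mult_nonneg_nonneg prod_nonneg simp: mult_ac)
  finally show ?case .
qed simp

lemma ancestors_singleton [simp]: "ancestors \<lparr>verts = V, edges = {}, root_vertex = r\<rparr> v = {v}"
  by (auto simp: ancestors_def)

lemma path_gf_nonneg: "y \<ge> 0 \<Longrightarrow> path_gf T y \<ge> 0"
  by (auto simp: path_gf_def intro!: sum_nonneg)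

lemma pair_gf_nonneg: "a \<ge> 0 \<Longrightarrow> b \<ge> 0 \<Longrightarrow> pair_gf T a b \<ge> 0"
  by (auto simp: pair_gf_def intro!: sum_nonneg)

lemma path_gf_random_recursive_tree:
  assumes "y \<ge> 0"
  shows "(\<integral>\<^sup>+T. ennreal (path_gf T y) \<partial>random_recursive_tree (Suc n))
           = ennreal (y * (\<Prod>j=1..n. 1 + y / real j))"
proof -
  have "(\<integral>\<^sup>+T. ennreal (path_gf T y) \<partial>random_recursive_tree (Suc n))
      = ennreal (path_gf \<lparr>verts = {1::nat}, edges = {}, root_vertex = 1\<rparr> y * (\<Prod>j=1..n. 1 + y / real j))"
  proof (rule nn_integral_random_recursive_tree_eigen)
    fix m :: nat and T :: "nat rooted_graph"
    assume T: "arborescence T" and V: "verts T = {1..m}"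
    have "(\<Sum>u\<in>verts T. path_gf (attach_child u (Suc m) T) y)
        = (\<Sum>u\<in>verts T. path_gf T y + y * y ^ card (ancestors T u))"
      by (intro sum.cong refl path_gf_attach_child[OF T]) (auto simp: V)
    also have "\<dots> = real m * path_gf T y + y * path_gf T y"
      by (simp add: sum.distrib V path_gf_def[of T y] flip: sum_distrib_left)
    finally show "(\<Sum>u\<in>verts T. path_gf (attach_child u (Suc m) T) y) = (real m + y) * path_gf T y"
      by (simp add: algebra_simps)
  qed (use assms path_gf_nonneg in auto)
  then show ?thesis by (simp add: path_gf_def)
qed

text \<open>
  By itself \<open>pair_gf\<close> satisfies a recursion with the inhomogeneous term \<open>b * path_gf T b\<close>, coming
  from the pair of the new vertex with itself. The multiple \<open>b / a\<close> of \<open>path_gf\<close> absorbs it.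
\<close>

lemma pair_gf_random_recursive_tree:
  assumes "a > 0" "b \<ge> 0"
  shows "(\<integral>\<^sup>+T. ennreal (pair_gf T a b + b / a * path_gf T b) \<partial>random_recursive_tree (Suc n))
           = ennreal (b * (1 + b / a) * (\<Prod>j=1..n. 1 + (a + b) / real j))"
proof -
  let ?g = "\<lambda>T. pair_gf T a b + b / a * path_gf T b"
  have "(\<integral>\<^sup>+T. ennreal (?g T) \<partial>random_recursive_tree (Suc n))
      = ennreal (?g \<lparr>verts = {1::nat}, edges = {}, root_vertex = 1\<rparr> * (\<Prod>j=1..n. 1 + (a + b) / real j))"
  proof (rule nn_integral_random_recursive_tree_eigen)
    fix m :: nat and T :: "nat rooted_graph"
    assume T: "arborescence T" and V: "verts T = {1..m}"
    have z: "Suc m \<notin> verts T" by (simp add: V)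
    have 1: "(\<Sum>u\<in>verts T. path_gf (attach_child u (Suc m) T) b) = (real m + b) * path_gf T b"
    proof -
      have "(\<Sum>u\<in>verts T. path_gf (attach_child u (Suc m) T) b)
          = (\<Sum>u\<in>verts T. path_gf T b + b * b ^ card (ancestors T u))"
        by (intro sum.cong refl path_gf_attach_child[OF T _ z])
      also have "\<dots> = real m * path_gf T b + b * path_gf T b"
        by (simp add: sum.distrib V path_gf_def[of T b] flip: sum_distrib_left)
      finally show ?thesis by (simp add: algebra_simps)
    qed
    let ?f = "\<lambda>w v. b ^ card (ancestors T w) * a ^ card (ancestors T v - ancestors T w)"
    have "(\<Sum>u\<in>verts T. pair_gf (attach_child u (Suc m) T) a b)
        = (\<Sum>u\<in>verts T. pair_gf T a b + b * (\<Sum>v\<in>verts T. ?f u v) + a * (\<Sum>w\<in>verts T. ?f w u)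
            + b * b ^ card (ancestors T u))"
      by (intro sum.cong refl pair_gf_attach_child[OF T _ z])
    also have "\<dots> = real m * pair_gf T a b + b * (\<Sum>u\<in>verts T. \<Sum>v\<in>verts T. ?f u v)
        + a * (\<Sum>u\<in>verts T. \<Sum>w\<in>verts T. ?f w u) + b * (\<Sum>u\<in>verts T. b ^ card (ancestors T u))"
      by (simp only: sum.distrib sum_distrib_left[symmetric]) (simp add: V)
    also have "(\<Sum>u\<in>verts T. \<Sum>w\<in>verts T. ?f w u) = pair_gf T a b"
      unfolding pair_gf_def by (rule sum.swap)
    also have "(\<Sum>u\<in>verts T. \<Sum>v\<in>verts T. ?f u v) = pair_gf T a b"
      unfolding pair_gf_def ..
    also have "(\<Sum>u\<in>verts T. b ^ card (ancestors T u)) = path_gf T b"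
      unfolding path_gf_def ..
    finally show "(\<Sum>u\<in>verts T. ?g (attach_child u (Suc m) T)) = (real m + (a + b)) * ?g T"
      unfolding sum.distrib sum_distrib_left[symmetric] 1 using assms by (simp add: field_simps)
  qed (use assms in \<open>auto intro!: add_nonneg_nonneg mult_nonneg_nonneg divide_nonneg_nonneg path_gf_nonneg pair_gf_nonneg\<close>)
  then show ?thesis using assms by (simp add: path_gf_def pair_gf_def algebra_simps)
qed

lemma mean_cuts_gf:
  assumes T: "arborescence T"
  shows "mean_cuts k T (\<lambda>_. 0) = (\<integral>\<^sup>+x\<in>{0..}. ennreal (path_gf T (surv k x)) \<partial>lborel)"
proof -
  have "ennreal (path_gf T (surv k x)) * indicator {0..} x
      = (\<Sum>v\<in>verts T. ennreal (path_surv k (\<lambda>_. 0) (ancestors T v) (\<lambda>_. 0) x) * indicator {0..} x)" for x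
    by (auto simp: indicator_def path_gf_def path_surv_def sum_ennreal)
  then show ?thesis
    by (simp add: mean_cuts_def surv_integral_def nn_integral_sum)
qed

lemma second_moment_cuts_gf:
  assumes T: "arborescence T"
  shows "second_moment_cuts k T (\<lambda>_. 0) = 2 * (\<integral>\<^sup>+r\<in>{0<..}. (\<integral>\<^sup>+x\<in>{0..}.
           ennreal (pair_gf T (surv k x) (surv k (x + r))) \<partial>lborel) \<partial>lborel)"
proof -
  let ?A = "ancestors T"
  let ?P = "\<lambda>r v w x. path_surv k (\<lambda>_. 0) (?A v \<union> ?A w) (\<lambda>u. if u \<in> ?A w then r else 0) x"
  have P: "?P r v w x = surv k (x + r) ^ card (?A w) * surv k x ^ card (?A v - ?A w)"
    if "v \<in> verts T" "w \<in> verts T" for v w r x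
  proof -
    have "?P r v w x = (\<Prod>u\<in>?A w. surv k (x + (if u \<in> ?A w then r else 0)))
       * (\<Prod>u\<in>?A v - ?A w. surv k (x + (if u \<in> ?A w then r else 0)))"
      unfolding path_surv_def using finite_ancestors[OF T] that
      by (subst prod.union_disjoint[symmetric]) (auto intro!: prod.cong)
    then show ?thesis by simp
  qed
  have 1: "(\<Sum>w\<in>verts T. \<Sum>v\<in>verts T.
        surv_integral k (\<lambda>_. 0) (?A v \<union> ?A w) (\<lambda>u. if u \<in> ?A w then r else 0))
      = (\<integral>\<^sup>+x\<in>{0..}. ennreal (pair_gf T (surv k x) (surv k (x + r))) \<partial>lborel)" if r: "r > 0" for r
  proof -
    have "ennreal (pair_gf T (surv k x) (surv k (x + r))) * indicator {0..} x
      = (\<Sum>w\<in>verts T. \<Sum>v\<in>verts T. ennreal (?P r v w x) * indicator {0..} x)" for x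
    proof (cases "x \<ge> 0")
      case True
      have "pair_gf T (surv k x) (surv k (x + r)) = (\<Sum>w\<in>verts T. \<Sum>v\<in>verts T. ?P r v w x)"
        unfolding pair_gf_def by (intro sum.cong refl) (simp add: P)
      moreover have "0 \<le> ?P r v w x" for v w
        using True r by (intro path_surv_bounds) auto
      ultimately show ?thesis
        using True by (simp add: sum_ennreal sum_nonneg)
    qed simp
    then show ?thesis
      by (simp add: surv_integral_def nn_integral_sum)
  qed
  show ?thesis unfolding second_moment_cuts_def
    by (intro arg_cong[where f = "(*) 2"] nn_integral_cong) (auto simp: indicator_def 1)
qed

lemma cut_number_alive_graph:
  assumes "k > 0"
  shows "cut_number k T = remaining_cuts k (alive_graph k T (\<lambda>_. 0), \<lambda>_. 0)"
  using assms by (simp add: cut_number_def alive_graph_def)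

lemma nn_integral_pmf_cmult: "(\<integral>\<^sup>+T. c * f T \<partial>measure_pmf M) = c * (\<integral>\<^sup>+T. f T \<partial>measure_pmf M)"
  by (rule nn_integral_cmult) simp

lemma nn_integral_pmf_multc: "(\<integral>\<^sup>+T. f T * c \<partial>measure_pmf M) = (\<integral>\<^sup>+T. f T \<partial>measure_pmf M) * c"
  by (rule nn_integral_multc) simp

lemma nn_integral_pmf_swap:
  assumes "finite (set_pmf M)" "\<And>T. f T \<in> borel_measurable N"
  shows "(\<integral>\<^sup>+T. \<integral>\<^sup>+x. f T x \<partial>N \<partial>measure_pmf M) = (\<integral>\<^sup>+x. \<integral>\<^sup>+T. f T x \<partial>measure_pmf M \<partial>N)"
  using assms by (simp add: nn_integral_measure_pmf_finite nn_integral_sum nn_integral_multc)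

lemma mean_cut_number_rrt:
  assumes "k > 0"
  shows "(\<integral>\<^sup>+m. of_nat m \<partial>cut_number_rrt k (Suc n))
           = (\<integral>\<^sup>+x\<in>{0..}. ennreal (surv k x * (\<Prod>j=1..n. 1 + surv k x / real j)) \<partial>lborel)"
proof -
  let ?M = "random_recursive_tree (Suc n)"
  have [measurable]: "(\<lambda>x. path_gf T (surv k x)) \<in> borel_measurable borel" for T :: "nat rooted_graph"
    unfolding path_gf_def by measurable
  have "(\<integral>\<^sup>+m. of_nat m \<partial>cut_number_rrt k (Suc n))
      = (\<integral>\<^sup>+T. \<integral>\<^sup>+m. of_nat m \<partial>cut_number k T \<partial>?M)"
    by (simp add: cut_number_rrt_def)
  also have "\<dots> = (\<integral>\<^sup>+T. (\<integral>\<^sup>+x\<in>{0..}. ennreal (path_gf T (surv k x)) \<partial>lborel) \<partial>?M)"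
  proof (rule nn_integral_cong_AE, unfold AE_measure_pmf_iff, intro ballI)
    fix T assume "T \<in> set_pmf ?M"
    then have T: "arborescence T" by (rule random_recursive_tree_arborescence)
    show "(\<integral>\<^sup>+m. of_nat m \<partial>cut_number k T) = (\<integral>\<^sup>+x\<in>{0..}. ennreal (path_gf T (surv k x)) \<partial>lborel)"
      unfolding cut_number_alive_graph[OF assms] expectation_remaining_cuts[OF T] mean_cuts_gf[OF T] ..
  qed
  also have "\<dots> = (\<integral>\<^sup>+x. \<integral>\<^sup>+T. ennreal (path_gf T (surv k x)) * indicator {0..} x \<partial>?M \<partial>lborel)"
    by (intro nn_integral_pmf_swap finite_set_pmf_random_recursive_tree) measurable
  also have "\<dots> = (\<integral>\<^sup>+x\<in>{0..}. ennreal (surv k x * (\<Prod>j=1..n. 1 + surv k x / real j)) \<partial>lborel)"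
    by (intro nn_integral_cong)
       (auto simp: nn_integral_multc path_gf_random_recursive_tree indicator_def simp del: random_recursive_tree.simps)
  finally show ?thesis .
qed

text \<open>
  Only an upper bound is needed. Dropping the nonnegative correction \<open>b / a * path_gf T b\<close> and using
  \<open>b \<le> a\<close> loses nothing to leading order, since both probabilities are near \<open>1\<close> at the relevant
  times.
\<close>

lemma second_moment_cut_number_rrt_le:
  assumes "k > 0"
  shows "(\<integral>\<^sup>+m. of_nat (m * (m + 1)) \<partial>cut_number_rrt k (Suc n))
     \<le> 2 * (\<integral>\<^sup>+r\<in>{0<..}. (\<integral>\<^sup>+x\<in>{0..}. ennreal (2 * surv k (x + r)
            * (\<Prod>j=1..n. 1 + (surv k x + surv k (x + r)) / real j)) \<partial>lborel) \<partial>lborel)"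
proof -
  let ?M = "random_recursive_tree (Suc n)"
  let ?f = "\<lambda>(T :: nat rooted_graph) r x. ennreal (pair_gf T (surv k x) (surv k (x + r))) * indicator {0..} x"
  have [measurable]: "(\<lambda>(r, x). pair_gf T (surv k x) (surv k (x + r))) \<in> borel_measurable (borel \<Otimes>\<^sub>M borel)"
    for T :: "nat rooted_graph"
    unfolding pair_gf_def by measurable
  have "(\<integral>\<^sup>+m. of_nat (m * (m + 1)) \<partial>cut_number_rrt k (Suc n))
      = (\<integral>\<^sup>+T. \<integral>\<^sup>+m. of_nat (m * (m + 1)) \<partial>cut_number k T \<partial>?M)"
    by (simp add: cut_number_rrt_def)
  also have "\<dots> = (\<integral>\<^sup>+T. 2 * (\<integral>\<^sup>+r. (\<integral>\<^sup>+x. ?f T r x \<partial>lborel) * indicator {0<..} r \<partial>lborel) \<partial>?M)"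
  proof (rule nn_integral_cong_AE, unfold AE_measure_pmf_iff, intro ballI)
    fix T assume "T \<in> set_pmf ?M"
    then have T: "arborescence T" by (rule random_recursive_tree_arborescence)
    show "(\<integral>\<^sup>+m. of_nat (m * (m + 1)) \<partial>cut_number k T)
        = 2 * (\<integral>\<^sup>+r. (\<integral>\<^sup>+x. ?f T r x \<partial>lborel) * indicator {0<..} r \<partial>lborel)"
      unfolding cut_number_alive_graph[OF assms] second_moment_remaining_cuts[OF T] second_moment_cuts_gf[OF T] ..
  qed
  also have "\<dots> = 2 * (\<integral>\<^sup>+r. \<integral>\<^sup>+T. (\<integral>\<^sup>+x. ?f T r x \<partial>lborel) * indicator {0<..} r \<partial>?M \<partial>lborel)"
  proof -
    have "(\<integral>\<^sup>+T. \<integral>\<^sup>+r. (\<integral>\<^sup>+x. ?f T r x \<partial>lborel) * indicator {0<..} r \<partial>lborel \<partial>?M)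
        = (\<integral>\<^sup>+r. \<integral>\<^sup>+T. (\<integral>\<^sup>+x. ?f T r x \<partial>lborel) * indicator {0<..} r \<partial>?M \<partial>lborel)"
      by (intro nn_integral_pmf_swap finite_set_pmf_random_recursive_tree) measurable
    then show ?thesis by (simp only: nn_integral_pmf_cmult)
  qed
  also have "\<dots> = 2 * (\<integral>\<^sup>+r\<in>{0<..}. (\<integral>\<^sup>+x. \<integral>\<^sup>+T. ?f T r x \<partial>?M \<partial>lborel) \<partial>lborel)"
  proof -
    have "(\<integral>\<^sup>+T. (\<integral>\<^sup>+x. ?f T r x \<partial>lborel) \<partial>?M) = (\<integral>\<^sup>+x. \<integral>\<^sup>+T. ?f T r x \<partial>?M \<partial>lborel)" for r
      by (intro nn_integral_pmf_swap finite_set_pmf_random_recursive_tree) measurable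
    then show ?thesis by (simp only: nn_integral_pmf_multc)
  qed
  also have "\<dots> \<le> 2 * (\<integral>\<^sup>+r\<in>{0<..}. (\<integral>\<^sup>+x\<in>{0..}. ennreal (2 * surv k (x + r)
            * (\<Prod>j=1..n. 1 + (surv k x + surv k (x + r)) / real j)) \<partial>lborel) \<partial>lborel)"
  proof (intro mult_left_mono nn_integral_mono)
    fix r :: real
    have *: "(\<integral>\<^sup>+T. ?f T r x \<partial>?M) \<le> ennreal (2 * surv k (x + r)
            * (\<Prod>j=1..n. 1 + (surv k x + surv k (x + r)) / real j)) * indicator {0..} x"
      if r: "r > 0" for x
    proof (cases "x \<ge> 0")
      case x: True
      define a b where "a = surv k x" and "b = surv k (x + r)"
      have ab: "a > 0" "b \<ge> 0" "b \<le> a"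
        using x r assms by (auto simp: a_def b_def surv_pos intro!: surv_antimono)
      have "(\<integral>\<^sup>+T. ennreal (pair_gf T a b) \<partial>?M)
          \<le> (\<integral>\<^sup>+T. ennreal (pair_gf T a b + b / a * path_gf T b) \<partial>?M)"
        using ab by (intro nn_integral_mono ennreal_leI) (auto intro!: mult_nonneg_nonneg divide_nonneg_nonneg path_gf_nonneg)
      also have "\<dots> = ennreal (b * (1 + b / a) * (\<Prod>j=1..n. 1 + (a + b) / real j))"
        by (rule pair_gf_random_recursive_tree[OF ab(1,2)])
      also have "\<dots> \<le> ennreal (2 * b * (\<Prod>j=1..n. 1 + (a + b) / real j))"
      proof (intro ennreal_leI mult_right_mono)
        have "b / a \<le> 1" using ab by simp
        then have "b * (1 + b / a) \<le> b * 2" using ab by (intro mult_left_mono) auto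
        then show "b * (1 + b / a) \<le> 2 * b" by simp
      qed (use ab in \<open>auto intro!: prod_nonneg\<close>)
      finally show ?thesis using x by (simp add: a_def b_def del: random_recursive_tree.simps)
    qed simp
    show "(\<integral>\<^sup>+x. \<integral>\<^sup>+T. ?f T r x \<partial>?M \<partial>lborel) * indicator {0<..} r
        \<le> (\<integral>\<^sup>+x\<in>{0..}. ennreal (2 * surv k (x + r)
            * (\<Prod>j=1..n. 1 + (surv k x + surv k (x + r)) / real j)) \<partial>lborel) * indicator {0<..} r"
    proof (cases "r > 0")
      case True
      then show ?thesis by (intro mult_right_mono nn_integral_mono *) auto
    qed simp
  qed simp
  finally show ?thesis .
qed

section \<open>Laplace's method\<close>

text \<open>
  Both orderings of a pair of distinct times contribute equally to the square, by Tonelli.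
\<close>

lemma double_integral_le_square:
  fixes g :: "real \<Rightarrow> ennreal"
  assumes [measurable]: "g \<in> borel_measurable borel"
  shows "2 * (\<integral>\<^sup>+r\<in>{0<..}. (\<integral>\<^sup>+x\<in>{0..}. g x * g (x + r) \<partial>lborel) \<partial>lborel)
           \<le> (\<integral>\<^sup>+x\<in>{0..}. g x \<partial>lborel)\<^sup>2"
proof -
  define G where "G x = g x * indicator {0..} x" for x
  have [measurable]: "G \<in> borel_measurable borel" unfolding G_def[abs_def] by measurable
  have [measurable]: "(\<lambda>(t, x :: real). indicator {x<..} t :: ennreal) \<in> borel_measurable (borel \<Otimes>\<^sub>M borel)"
    "(\<lambda>(x, t :: real). indicator {x<..} t :: ennreal) \<in> borel_measurable (borel \<Otimes>\<^sub>M borel)"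
    unfolding indicator_def greaterThan_iff by measurable
  define D where "D = (\<integral>\<^sup>+x. (\<integral>\<^sup>+t. G x * G t * indicator {x<..} (t :: real) \<partial>lborel) \<partial>lborel)"
  have "(\<integral>\<^sup>+r\<in>{0<..}. (\<integral>\<^sup>+x\<in>{0..}. g x * g (x + r) \<partial>lborel) \<partial>lborel)
      = (\<integral>\<^sup>+r. (\<integral>\<^sup>+x. G x * G (x + r) * indicator {0<..} r \<partial>lborel) \<partial>lborel)"
  proof (rule nn_integral_cong)
    fix r :: real
    show "(\<integral>\<^sup>+x\<in>{0..}. g x * g (x + r) \<partial>lborel) * indicator {0<..} r
        = (\<integral>\<^sup>+x. G x * G (x + r) * indicator {0<..} r \<partial>lborel)"
      by (subst nn_integral_multc[symmetric], simp)
         (auto intro!: nn_integral_cong simp: G_def indicator_def)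
  qed
  also have "\<dots> = (\<integral>\<^sup>+x. (\<integral>\<^sup>+r. G x * G (x + r) * indicator {0<..} r \<partial>lborel) \<partial>lborel)"
    by (rule lborel_pair.Fubini') measurable
  also have "\<dots> = D"
    unfolding D_def
  proof (rule nn_integral_cong)
    fix x :: real
    have "(\<integral>\<^sup>+t. G x * G t * indicator {x<..} t \<partial>lborel)
        = (\<integral>\<^sup>+r. G x * G (x + 1 * r) * indicator {x<..} (x + 1 * r) \<partial>lborel)"
      by (subst nn_integral_real_affine[where c = 1 and t = x]) auto
    then show "(\<integral>\<^sup>+r. G x * G (x + r) * indicator {0<..} r \<partial>lborel) = (\<integral>\<^sup>+t. G x * G t * indicator {x<..} t \<partial>lborel)"
      by (simp add: indicator_def)
  qed
  finally have 1: "(\<integral>\<^sup>+r\<in>{0<..}. (\<integral>\<^sup>+x\<in>{0..}. g x * g (x + r) \<partial>lborel) \<partial>lborel) = D" .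
  have D': "D = (\<integral>\<^sup>+x. (\<integral>\<^sup>+t. G x * G t * indicator {t<..} (x :: real) \<partial>lborel) \<partial>lborel)"
    unfolding D_def by (subst lborel_pair.Fubini') (auto simp: mult.commute)
  have "2 * D = D + D" by (simp add: mult_2)
  also have "\<dots> = (\<integral>\<^sup>+x. (\<integral>\<^sup>+t. G x * G t * indicator {x<..} t \<partial>lborel)
                  + (\<integral>\<^sup>+t. G x * G t * indicator {t<..} x \<partial>lborel) \<partial>lborel)"
    by (subst (2) D', subst D_def, rule nn_integral_add[symmetric]) measurable
  also have "\<dots> = (\<integral>\<^sup>+x. (\<integral>\<^sup>+t. G x * G t * indicator {x<..} t + G x * G t * indicator {t<..} x \<partial>lborel) \<partial>lborel)"
    by (intro nn_integral_cong nn_integral_add[symmetric]) measurable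
  also have "\<dots> \<le> (\<integral>\<^sup>+x. (\<integral>\<^sup>+t. G x * G t \<partial>lborel) \<partial>lborel)"
    by (intro nn_integral_mono) (auto simp: indicator_def)
  also have "\<dots> = (\<integral>\<^sup>+x. G x \<partial>lborel)\<^sup>2"
    by (simp add: nn_integral_cmult nn_integral_multc power2_eq_square)
  finally show ?thesis unfolding 1 by (simp add: G_def)
qed

text \<open>
  Layer-cake argument: write \<open>exp (- a x\<^sup>k)\<close> as the integral of \<open>exp (- t)\<close> over \<open>t \<ge> a x\<^sup>k\<close> and
  exchange the integrals. The inner integral becomes the length of an interval,
  \<open>(t / a)\<^bsup>1/k\<^esup>\<close>, and what remains is Euler's integral.
\<close>

lemma nn_integral_exp_neg_power:
  assumes k: "k \<ge> 1" and a: "a > 0"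
  shows "(\<integral>\<^sup>+x\<in>{0..}. ennreal (exp (- (a * x ^ k))) \<partial>lborel)
           = ennreal ((1 / a) powr (1 / real k) * Gamma (1 + 1 / real k))"
proof -
  have tail: "(\<integral>\<^sup>+t. ennreal (exp (- t)) * indicator {y..} t \<partial>lborel) = ennreal (exp (- y))" for y :: real
  proof -
    have lim: "((\<lambda>t. - exp (- t)) \<longlongrightarrow> (0::real)) at_top"
      by real_asymp
    have "(\<integral>\<^sup>+t. ennreal (exp (- t)) * indicator {y..} t \<partial>lborel) = ennreal (0 - (- exp (- y)))"
      by (rule nn_integral_FTC_atLeast[OF _ _ _ lim]) (auto intro!: derivative_eq_intros)
    then show ?thesis by simp
  qed
  have "(\<integral>\<^sup>+x\<in>{0..}. ennreal (exp (- (a * x ^ k))) \<partial>lborel)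
      = (\<integral>\<^sup>+x. (\<integral>\<^sup>+t. ennreal (exp (- t)) * indicator {a * x ^ k..} t * indicator {0..} x \<partial>lborel) \<partial>lborel)"
    by (intro nn_integral_cong) (simp add: nn_integral_multc tail)
  also have "\<dots> = (\<integral>\<^sup>+t. (\<integral>\<^sup>+x. ennreal (exp (- t)) * indicator {a * x ^ k..} t * indicator {0..} x \<partial>lborel) \<partial>lborel)"
  proof (rule lborel_pair.Fubini')
    show "(\<lambda>(t, x). ennreal (exp (- t)) * indicator {a * x ^ k..} t * indicator {0..} x)
        \<in> borel_measurable (lborel \<Otimes>\<^sub>M lborel)"
      unfolding indicator_def atLeast_iff by measurable
  qed
  also have "\<dots> = (\<integral>\<^sup>+t. ennreal ((1 / a) powr (1 / real k))
      * ennreal (indicator {0..} t * t powr ((1 + 1 / real k) - 1) / exp t) \<partial>lborel)"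
  proof (rule nn_integral_cong)
    fix t :: real
    show "(\<integral>\<^sup>+x. ennreal (exp (- t)) * indicator {a * x ^ k..} t * indicator {0..} x \<partial>lborel)
        = ennreal ((1 / a) powr (1 / real k)) * ennreal (indicator {0..} t * t powr ((1 + 1 / real k) - 1) / exp t)"
    proof (cases "t \<ge> 0")
      case True
      have root: "0 \<le> x \<and> a * x ^ k \<le> t \<longleftrightarrow> 0 \<le> x \<and> x \<le> root k (t / a)" for x
      proof -
        have "x ^ k \<le> t / a \<longleftrightarrow> x \<le> root k (t / a)" if "0 \<le> x"
          using that True a k real_root_le_iff[of k "x ^ k" "t / a"] real_root_power_cancel[of k x] by simp
        then show ?thesis using a by (auto simp: field_simps)
      qed
      have "(\<integral>\<^sup>+x. ennreal (exp (- t)) * indicator {a * x ^ k..} t * indicator {0..} x \<partial>lborel)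
          = (\<integral>\<^sup>+x. ennreal (exp (- t)) * indicator {0..root k (t / a)} x \<partial>lborel)"
        using root by (intro nn_integral_cong) (auto simp: indicator_def)
      also have "\<dots> = ennreal (exp (- t)) * ennreal (root k (t / a))"
        using real_root_ge_zero[of "t / a" k] True a by (simp add: nn_integral_cmult_indicator)
      also have "root k (t / a) = (1 / a) powr (1 / real k) * t powr (1 / real k)"
      proof (cases "t = 0")
        case False
        then show ?thesis
          using True a k by (simp add: root_powr_inverse powr_mult[symmetric] inverse_eq_divide)
      qed (use k in simp)
      also have "ennreal (exp (- t)) * ennreal ((1 / a) powr (1 / real k) * t powr (1 / real k))
          = ennreal ((1 / a) powr (1 / real k)) * ennreal (t powr (1 / real k) / exp t)"
        by (simp add: exp_minus divide_inverse mult_ac flip: ennreal_mult)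
      finally show ?thesis using True by simp
    next
      case False
      have "a * x ^ k \<le> t \<longleftrightarrow> False" if "x \<ge> 0" for x
        using False a that by (smt (verit) mult_nonneg_nonneg zero_le_power)
      then have "(\<integral>\<^sup>+x. ennreal (exp (- t)) * indicator {a * x ^ k..} t * indicator {0..} x \<partial>lborel) = (\<integral>\<^sup>+x. 0 \<partial>(lborel :: real measure))"
        by (intro nn_integral_cong) (auto simp: indicator_def)
      then show ?thesis using False by simp
    qed
  qed
  also have "\<dots> = ennreal ((1 / a) powr (1 / real k)) * ennreal (Gamma (1 + 1 / real k))"
    using Gamma_conv_nn_integral_real[of "1 + 1 / real k"] by (subst nn_integral_cmult) (auto simp: add_pos_nonneg)
  also have "\<dots> = ennreal ((1 / a) powr (1 / real k) * Gamma (1 + 1 / real k))"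
    by (intro ennreal_mult[symmetric] Gamma_real_nonneg) (auto intro: add_pos_nonneg)
  finally show ?thesis .
qed

lemma exp_neg_power_integrable:
  assumes k: "k \<ge> 1" and a: "a > 0"
  shows "integrable lborel (\<lambda>x. indicator {0..} x * exp (- (a * x ^ k)) :: real)"
    and "(\<integral>x. indicator {0..} x * exp (- (a * x ^ k)) \<partial>lborel) = (1 / a) powr (1 / real k) * Gamma (1 + 1 / real k)"
proof -
  have "(\<integral>\<^sup>+x. ennreal (indicator {0..} x * exp (- (a * x ^ k))) \<partial>lborel)
      = ennreal ((1 / a) powr (1 / real k) * Gamma (1 + 1 / real k))"
    unfolding nn_integral_exp_neg_power[OF assms, symmetric]
    by (intro nn_integral_cong) (auto simp: indicator_def)
  then have "has_bochner_integral lborel (\<lambda>x. indicator {0..} x * exp (- (a * x ^ k)))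
      ((1 / a) powr (1 / real k) * Gamma (1 + 1 / real k))"
    by (intro has_bochner_integral_nn_integral) (auto intro!: mult_nonneg_nonneg Gamma_real_nonneg add_pos_nonneg)
  then show "integrable lborel (\<lambda>x. indicator {0..} x * exp (- (a * x ^ k)) :: real)"
    and "(\<integral>x. indicator {0..} x * exp (- (a * x ^ k)) \<partial>lborel) = (1 / a) powr (1 / real k) * Gamma (1 + 1 / real k)"
    by (auto simp: has_bochner_integral_iff)
qed

definition laplace_integral :: "nat \<Rightarrow> (real \<Rightarrow> real) \<Rightarrow> real \<Rightarrow> real" where
  "laplace_integral k h L = (\<integral>x. indicator {0..} x * (h x * exp (- (L * (1 - surv k x)))) \<partial>lborel)"

lemma laplace_integrable:
  fixes h :: "real \<Rightarrow> real"
  assumes [measurable]: "h \<in> borel_measurable borel"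
    and h: "\<And>x. x \<ge> 0 \<Longrightarrow> 0 \<le> h x" "\<And>x. x \<ge> 0 \<Longrightarrow> h x \<le> B * exp (- (x / 4))" and L: "L \<ge> 0"
  shows "integrable lborel (\<lambda>x. indicator {0..} x * (h x * exp (- (L * (1 - surv k x)))))"
proof (rule Bochner_Integration.integrable_bound)
  have "integrable lborel (\<lambda>x. indicator {0..} x * exp (- ((1 / 4) * x ^ 1)) :: real)"
    by (rule exp_neg_power_integrable) auto
  then show "integrable lborel (\<lambda>x. B * (indicator {0..} x * exp (- ((1 / 4) * x ^ 1))) :: real)"
    by (rule integrable_mult_right)
  have "\<bar>h x * exp (- (L * (1 - surv k x)))\<bar> \<le> \<bar>B\<bar> * exp (- (x / 4))" if "x \<ge> 0" for x
  proof -
    have "\<bar>h x * exp (- (L * (1 - surv k x)))\<bar> = h x * exp (- (L * (1 - surv k x)))"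
      using h(1)[OF that] by simp
    also have "\<dots> \<le> h x * 1"
      using h(1)[OF that] L surv_le_1[OF that, of k] by (intro mult_left_mono) auto
    also have "\<dots> \<le> B * exp (- (x / 4))" using h(2)[OF that] by simp
    also have "\<dots> \<le> \<bar>B\<bar> * exp (- (x / 4))" by (intro mult_right_mono) auto
    finally show ?thesis .
  qed
  then show "AE x in lborel. norm (indicator {0..} x * (h x * exp (- (L * (1 - surv k x)))))
      \<le> norm (B * (indicator {0..} x * exp (- ((1 / 4) * x ^ 1))))"
    by (auto simp: indicator_def abs_mult)
qed measurable

text \<open>
  The mass sits at times of order \<open>L\<^bsup>- 1/k\<^esup>\<close>. On \<open>[0, 1]\<close> this scaling is substituted and dominated
  convergence applies, with the lower bound for \<open>1 - surv k x\<close> providing the majorant; beyond \<open>1\<close>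
  the exponential factor is at most \<open>exp (- L d)\<close> for a fixed \<open>d > 0\<close>, which beats the power of \<open>L\<close>.
\<close>

lemma laplace_method:
  fixes h :: "real \<Rightarrow> real"
  assumes k: "k \<ge> 1" and [measurable]: "h \<in> borel_measurable borel"
    and h: "\<And>x. x \<ge> 0 \<Longrightarrow> 0 \<le> h x" "\<And>x. x \<ge> 0 \<Longrightarrow> h x \<le> B * exp (- (x / 4))"
    and lim: "(h \<longlongrightarrow> 1) (at_right 0)"
  shows "((\<lambda>L. L powr (1 / real k) * laplace_integral k h L)
           \<longlongrightarrow> fact k powr (1 / real k) * Gamma (1 + 1 / real k)) at_top"
proof -
  define e where "e L = L powr - (1 / real k)" for L :: real
  define f where "f L x = h x * exp (- (L * (1 - surv k x)))" for L x
  define s where "s L x = indicator {0..1} (e L * x) * f L (e L * x)" for L x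
  have [measurable]: "f L \<in> borel_measurable borel" for L
    unfolding f_def[abs_def] by measurable
  have [measurable]: "s L \<in> borel_measurable borel" for L
    unfolding s_def[abs_def] by measurable
  have B: "0 \<le> B" using h(1)[of 0] h(2)[of 0] by simp
  have e_pos: "e L > 0" if "L > 0" for L using that by (simp add: e_def)
  have e_pow: "L * (e L * x) ^ k = x ^ k" if "L > 0" for L x
  proof -
    have "e L ^ k = L powr - 1"
      using that k by (simp add: e_def powr_power)
    then show ?thesis using that by (simp add: power_mult_distrib powr_minus)
  qed
  have e_lim: "filterlim e (at_right 0) at_top"
  proof (rule tendsto_imp_filterlim_at_right)
    show "(e \<longlongrightarrow> 0) at_top"
      unfolding e_def[abs_def] using k by (intro tendsto_neg_powr filterlim_ident) auto
    show "\<forall>\<^sub>F L in at_top. 0 < e L"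
      using eventually_gt_at_top[of 0] by eventually_elim (rule e_pos)
  qed
  have split: "L powr (1 / real k) * laplace_integral k h L
      = (\<integral>x. s L x \<partial>lborel) + L powr (1 / real k) * (\<integral>x. indicator {1<..} x * f L x \<partial>lborel)"
    if L: "L > 0" for L
  proof -
    have int: "integrable lborel (\<lambda>x. indicator {0..} x * f L x)"
      unfolding f_def using laplace_integrable[OF assms(2) h] L by simp
    have int1: "integrable lborel (\<lambda>x. indicator {0..1} x * f L x)"
      by (rule Bochner_Integration.integrable_bound[OF int]) (auto simp: indicator_def)
    have int2: "integrable lborel (\<lambda>x. indicator {1<..} x * f L x)"
      by (rule Bochner_Integration.integrable_bound[OF int]) (auto simp: indicator_def)
    have "laplace_integral k h L = (\<integral>x. indicator {0..1} x * f L x + indicator {1<..} x * f L x \<partial>lborel)"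
      unfolding laplace_integral_def f_def[symmetric]
      by (intro Bochner_Integration.integral_cong) (auto simp: indicator_def)
    also have "\<dots> = (\<integral>x. indicator {0..1} x * f L x \<partial>lborel) + (\<integral>x. indicator {1<..} x * f L x \<partial>lborel)"
      by (rule Bochner_Integration.integral_add[OF int1 int2])
    also have "(\<integral>x. indicator {0..1} x * f L x \<partial>lborel) = e L * (\<integral>x. s L x \<partial>lborel)"
      using e_pos[OF L] by (subst lborel_integral_real_affine[where c = "e L" and t = 0]) (auto simp: s_def[abs_def])
    finally show ?thesis
      using L by (simp add: distrib_left e_def powr_minus mult.assoc[symmetric])
  qed
  have main: "((\<lambda>L. \<integral>x. s L x \<partial>lborel) \<longlongrightarrow> (\<integral>x. indicator {0..} x * exp (- ((1 / fact k) * x ^ k)) \<partial>lborel)) at_top"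
  proof (rule integral_dominated_convergence_at_top)
    have "integrable lborel (\<lambda>x. indicator {0..} x * exp (- ((exp (- 1) / fact k) * x ^ k)) :: real)"
      by (rule exp_neg_power_integrable[OF k]) auto
    then show "integrable lborel (\<lambda>x. B * (indicator {0..} x * exp (- ((exp (- 1) / fact k) * x ^ k))) :: real)"
      by (rule integrable_mult_right)
    have bound: "\<bar>s L x\<bar> \<le> B * (indicator {0..} x * exp (- ((exp (- 1) / fact k) * x ^ k)))"
      if L: "L > 0" for L x
    proof (cases "0 \<le> e L * x \<and> e L * x \<le> 1")
      case True
      define y where "y = e L * x"
      have y: "0 \<le> y" "y \<le> 1" using True by (auto simp: y_def)
      have x: "x \<ge> 0" using True e_pos[OF L] by (simp add: zero_le_mult_iff)
      have "(exp (- 1) / fact k) * x ^ k = L * (exp (- 1) * (y ^ k / fact k))"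
        using e_pow[OF L, of x] by (simp add: y_def field_simps)
      also have "\<dots> \<le> L * (exp (- y) * (y ^ k / fact k))"
        using y L by (intro mult_left_mono mult_right_mono) auto
      also have "\<dots> \<le> L * (1 - surv k y)"
        using L one_minus_surv_lower[OF y(1), of k] by (intro mult_left_mono) auto
      finally have *: "exp (- (L * (1 - surv k y))) \<le> exp (- ((exp (- 1) / fact k) * x ^ k))"
        by simp
      have "\<bar>s L x\<bar> = h y * exp (- (L * (1 - surv k y)))"
        using y h(1)[OF y(1)] by (simp add: s_def f_def abs_mult flip: y_def)
      also have "\<dots> \<le> B * exp (- ((exp (- 1) / fact k) * x ^ k))"
      proof (intro mult_mono *)
        have "h y \<le> B * exp (- (y / 4))" by (rule h(2)[OF y(1)])
        also have "\<dots> \<le> B * 1" using y B by (intro mult_left_mono) auto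
        finally show "h y \<le> B" by simp
      qed (use B in auto)
      finally show ?thesis
        using x by simp
    next
      case False
      then show ?thesis using B by (auto simp: s_def indicator_def)
    qed
    show "\<forall>\<^sub>F L in at_top. AE x in lborel. norm (s L x) \<le> B * (indicator {0..} x * exp (- ((exp (- 1) / fact k) * x ^ k)))"
      using eventually_gt_at_top[of 0]
    proof eventually_elim
      case (elim L)
      show ?case using bound[OF elim] by (intro AE_I2) (simp only: real_norm_def)
    qed
    have "((\<lambda>L. s L x) \<longlongrightarrow> indicator {0..} x * exp (- ((1 / fact k) * x ^ k))) at_top" if x: "x \<noteq> 0" for x
    proof (cases "x > 0")
      case True
      have ex: "filterlim (\<lambda>L. e L * x) (at_right 0) at_top"
      proof (rule tendsto_imp_filterlim_at_right)
        show "((\<lambda>L. e L * x) \<longlongrightarrow> 0) at_top"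
          using e_lim by (intro tendsto_mult_left_zero) (simp add: filterlim_at)
        show "\<forall>\<^sub>F L in at_top. 0 < e L * x"
          using eventually_gt_at_top[of 0] by eventually_elim (use e_pos True in simp)
      qed
      have exponent: "((\<lambda>L. L * (1 - surv k (e L * x))) \<longlongrightarrow> 1 / fact k * x ^ k) at_top"
      proof (rule tendsto_sandwich)
        show "\<forall>\<^sub>F L in at_top. exp (- (e L * x)) * (1 / fact k * x ^ k) \<le> L * (1 - surv k (e L * x))"
          using eventually_gt_at_top[of 0]
        proof eventually_elim
          case (elim L)
          have "exp (- (e L * x)) * (1 / fact k * x ^ k) = L * (exp (- (e L * x)) * ((e L * x) ^ k / fact k))"
            using e_pow[OF elim, of x] by (simp add: field_simps)
          also have "\<dots> \<le> L * (1 - surv k (e L * x))"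
            using elim True e_pos[OF elim] by (intro mult_left_mono one_minus_surv_lower) auto
          finally show ?case .
        qed
        show "\<forall>\<^sub>F L in at_top. L * (1 - surv k (e L * x)) \<le> 1 / fact k * x ^ k"
          using eventually_gt_at_top[of 0]
        proof eventually_elim
          case (elim L)
          have "L * (1 - surv k (e L * x)) \<le> L * ((e L * x) ^ k / fact k)"
            using elim True e_pos[OF elim] by (intro mult_left_mono one_minus_surv_upper) auto
          also have "\<dots> = 1 / fact k * x ^ k"
            using e_pow[OF elim, of x] by (simp add: field_simps)
          finally show ?case .
        qed
        have "((\<lambda>L. exp (- (e L * x)) * (1 / fact k * x ^ k)) \<longlongrightarrow> exp (- 0) * (1 / fact k * x ^ k)) at_top"
          using ex by (intro tendsto_intros) (auto simp: filterlim_at)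
        then show "((\<lambda>L. exp (- (e L * x)) * (1 / fact k * x ^ k)) \<longlongrightarrow> 1 / fact k * x ^ k) at_top"
          by simp
      qed auto
      have "((\<lambda>L. h (e L * x) * exp (- (L * (1 - surv k (e L * x))))) \<longlongrightarrow> 1 * exp (- (1 / fact k * x ^ k))) at_top"
        by (rule tendsto_mult[OF filterlim_compose[OF lim ex] tendsto_exp[OF tendsto_minus[OF exponent]]])
      moreover have "\<forall>\<^sub>F L in at_top. h (e L * x) * exp (- (L * (1 - surv k (e L * x)))) = s L x"
      proof -
        have "\<forall>\<^sub>F L in at_top. e L * x \<in> {0<..<1}"
          by (rule eventually_compose_filterlim[OF eventually_at_right_real[OF zero_less_one] ex])
        then show ?thesis
          by eventually_elim (auto simp: s_def f_def)
      qed
      ultimately show ?thesis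
        using True by (simp add: tendsto_cong)
    next
      case False
      have "\<forall>\<^sub>F L in at_top. s L x = indicator {0..} x * exp (- ((1 / fact k) * x ^ k))"
        using eventually_gt_at_top[of 0]
      proof eventually_elim
        case (elim L)
        have "x < 0" using False x by simp
        then have "e L * x < 0" using e_pos[OF elim] by (simp add: mult_less_0_iff)
        with \<open>x < 0\<close> show ?case by (simp add: s_def)
      qed
      then show ?thesis by (rule tendsto_eventually)
    qed
    then show "AE x in lborel. ((\<lambda>L. s L x) \<longlongrightarrow> indicator {0..} x * exp (- ((1 / fact k) * x ^ k))) at_top"
      by (intro eventually_mono[OF AE_lborel_singleton[of 0]]) auto
  qed measurable
  define d :: real where "d = exp (- 1) / fact k"
  have d: "d > 0" by (simp add: d_def)
  have tail: "((\<lambda>L. L powr (1 / real k) * (\<integral>x. indicator {1<..} x * f L x \<partial>lborel)) \<longlongrightarrow> 0) at_top"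
  proof (rule tendsto_sandwich)
    define J where "J = (\<integral>x. indicator {0..} x * (h x * exp (- (0 * (1 - surv k x)))) \<partial>lborel)"
    have bnd: "0 \<le> (\<integral>x. indicator {1<..} x * f L x \<partial>lborel) \<and> (\<integral>x. indicator {1<..} x * f L x \<partial>lborel) \<le> exp (- (L * d)) * J"
      if L: "L \<ge> 0" for L
    proof
      show "0 \<le> (\<integral>x. indicator {1<..} x * f L x \<partial>lborel)"
        using h(1) by (intro Bochner_Integration.integral_nonneg) (auto simp: f_def indicator_def)
      have J: "integrable lborel (\<lambda>x. indicator {0..} x * (h x * exp (- (0 * (1 - surv k x)))))"
        by (rule laplace_integrable[OF assms(2) h]) auto
      show "(\<integral>x. indicator {1<..} x * f L x \<partial>lborel) \<le> exp (- (L * d)) * J"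
      proof -
        have "(\<integral>x. indicator {1<..} x * f L x \<partial>lborel)
            \<le> (\<integral>x. exp (- (L * d)) * (indicator {0..} x * (h x * exp (- (0 * (1 - surv k x))))) \<partial>lborel)"
        proof (rule integral_mono_AE')
        show "integrable lborel (\<lambda>x. exp (- (L * d)) * (indicator {0..} x * (h x * exp (- (0 * (1 - surv k x))))))"
          using J by (rule integrable_mult_right)
        have "f L x \<le> exp (- (L * d)) * h x" if x: "x > 1" for x
        proof -
          have "d \<le> 1 - surv k 1"
            using one_minus_surv_lower[of 1 k] by (simp add: d_def)
          also have "\<dots> \<le> 1 - surv k x"
            using surv_antimono[of 1 x k] x by simp
          finally have "L * d \<le> L * (1 - surv k x)" using L by (rule mult_left_mono)
          then have "h x * exp (- (L * (1 - surv k x))) \<le> h x * exp (- (L * d))"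
            using h(1)[of x] x by (intro mult_left_mono) auto
          then show ?thesis by (simp add: f_def mult.commute)
        qed
        then show "AE x in lborel. indicator {1<..} x * f L x \<le> exp (- (L * d)) * (indicator {0..} x * (h x * exp (- (0 * (1 - surv k x)))))"
          using h(1) by (auto simp: indicator_def)
        show "AE x in lborel. 0 \<le> exp (- (L * d)) * (indicator {0..} x * (h x * exp (- (0 * (1 - surv k x)))))"
          using h(1) by (auto simp: indicator_def f_def)
        qed
        also have "\<dots> = exp (- (L * d)) * J"
          unfolding J_def by (rule integral_mult_right_zero)
        finally show ?thesis .
      qed
    qed
    show "\<forall>\<^sub>F L in at_top. 0 \<le> L powr (1 / real k) * (\<integral>x. indicator {1<..} x * f L x \<partial>lborel)"
      using eventually_ge_at_top[of 0] by eventually_elim (use bnd in simp)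
    show "\<forall>\<^sub>F L in at_top. L powr (1 / real k) * (\<integral>x. indicator {1<..} x * f L x \<partial>lborel) \<le> L * exp (- (L * d)) * J"
      using eventually_ge_at_top[of 1]
    proof eventually_elim
      case (elim L)
      have "L powr (1 / real k) \<le> L powr 1"
        using elim k by (intro powr_mono) auto
      then have "L powr (1 / real k) \<le> L" using elim by simp
      then have "L powr (1 / real k) * (\<integral>x. indicator {1<..} x * f L x \<partial>lborel) \<le> L * (exp (- (L * d)) * J)"
        using bnd[of L] elim by (intro mult_mono) auto
      then show ?case by simp
    qed
    have "((\<lambda>L. L * exp (- (L * d))) \<longlongrightarrow> 0) at_top"
      using d by real_asymp
    from tendsto_mult_left_zero[OF this] show "((\<lambda>L. L * exp (- (L * d)) * J) \<longlongrightarrow> 0) at_top" .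
  qed auto
  have "(\<integral>x. indicator {0..} x * exp (- ((1 / fact k) * x ^ k)) \<partial>lborel) = fact k powr (1 / real k) * Gamma (1 + 1 / real k)"
    by (subst exp_neg_power_integrable(2)[OF k]) auto
  with tendsto_add[OF main tail]
  have "((\<lambda>L. (\<integral>x. s L x \<partial>lborel) + L powr (1 / real k) * (\<integral>x. indicator {1<..} x * f L x \<partial>lborel))
      \<longlongrightarrow> fact k powr (1 / real k) * Gamma (1 + 1 / real k)) at_top"
    by simp
  moreover have "\<forall>\<^sub>F L in at_top. (\<integral>x. s L x \<partial>lborel) + L powr (1 / real k) * (\<integral>x. indicator {1<..} x * f L x \<partial>lborel)
      = L powr (1 / real k) * laplace_integral k h L"
    using eventually_gt_at_top[of 0] by eventually_elim (simp add: split)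
  ultimately show ?thesis by (rule Lim_transform_eventually)
qed

section \<open>Moment bounds and convergence\<close>

text \<open>
  The product telescopes for \<open>q = 1\<close>; for smaller \<open>q\<close> each factor satisfies
  \<open>(1 + 1/j)\<^sup>q \<le> 1 + q/j\<close> by concavity.
\<close>

lemma prod_rising_lower:
  assumes "0 \<le> q" "q \<le> 1"
  shows "exp (q * ln (real (Suc n))) \<le> (\<Prod>j=1..n. 1 + q / real j)"
proof (induction n)
  case (Suc n)
  let ?N = "real (Suc n)"
  have N: "?N > 0" by simp
  have "exp (q * ln (real (Suc (Suc n)))) = exp (q * ln ?N) * exp (q * (ln (real (Suc (Suc n))) - ln ?N))"
    by (simp add: right_diff_distrib flip: exp_add)
  also have "ln (real (Suc (Suc n))) - ln ?N = ln (1 + 1 / ?N)"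
  proof -
    have "1 + 1 / ?N = real (Suc (Suc n)) / ?N"
      using N by (simp add: field_simps)
    moreover have "ln (real (Suc (Suc n)) / ?N) = ln (real (Suc (Suc n))) - ln ?N"
      by (rule ln_divide_pos) simp_all
    ultimately show ?thesis by simp
  qed
  also have "exp (q * ln (1 + 1 / ?N)) \<le> 1 + q / ?N"
  proof -
    have pos: "1 + 1 / ?N > 0" by (simp add: add_pos_nonneg)
    have "(1 + 1 / ?N) powr q * 1 powr (1 - q) \<le> q * (1 + 1 / ?N) + (1 - q) * 1"
      using assms pos by (intro Youngs_inequality_0) auto
    then show ?thesis using pos by (simp add: powr_def algebra_simps)
  qed
  finally have "exp (q * ln (real (Suc (Suc n)))) \<le> exp (q * ln ?N) * (1 + q / ?N)"
    by simp
  also have "\<dots> \<le> (\<Prod>j=1..n. 1 + q / real j) * (1 + q / ?N)"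
    using Suc assms by (intro mult_right_mono) auto
  finally show ?case by simp
qed simp

text \<open>
  The comparison is with the product for \<open>y = 2\<close>, which telescopes to \<open>(n + 1) (n + 2) / 2\<close>. That
  value is attained at the exponent \<open>2 - y = 0\<close>, so the bound is sharp where \<open>a\<close> and \<open>b\<close> are near \<open>1\<close>.
  The induction carries \<open>ln (n + 3)\<close> in place of \<open>ln (n + 1)\<close>, since the quotient of the factors is
  \<open>1 - (2 - y) / (n + 3)\<close> and \<open>ln (n + 4) - ln (n + 3) \<le> 1 / (n + 3)\<close>.
\<close>

lemma prod_rising_upper:
  assumes "0 \<le> y" "y \<le> 2"
  shows "(\<Prod>j=1..n. 1 + y / real j)
           \<le> real (Suc n) * real (Suc (Suc n)) / 2 * exp (- ((2 - y) * (ln (real (Suc n)) - ln 3)))"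
proof -
  have "(\<Prod>j=1..n. 1 + y / real j)
      \<le> real (Suc n) * real (Suc (Suc n)) / 2 * exp (- ((2 - y) * (ln (real n + 3) - ln 3)))"
  proof (induction n)
    case (Suc n)
    let ?N = "real n"
    let ?E = "\<lambda>t. exp (- ((2 - y) * (ln t - ln 3)))"
    have "ln (?N + 4) - ln (?N + 3) = ln (1 + 1 / (?N + 3))"
    proof -
      have "1 + 1 / (?N + 3) = (?N + 4) / (?N + 3)" by (simp add: field_simps)
      moreover have "ln ((?N + 4) / (?N + 3)) = ln (?N + 4) - ln (?N + 3)"
        by (rule ln_divide_pos) simp_all
      ultimately show ?thesis by simp
    qed
    also have "\<dots> \<le> 1 / (?N + 3)" by (rule ln_add_one_self_le_self) simp
    finally have ln: "ln (?N + 4) - ln (?N + 3) \<le> 1 / (?N + 3)" .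
    have "1 + y / real (Suc n) = (?N + 3) / (?N + 1) * (1 + (- ((2 - y) / (?N + 3))))"
    proof -
      define t where "t = ?N + 3"
      have t: "t > 2" "real (Suc n) = t - 2" "?N + 1 = t - 2" by (auto simp: t_def)
      have "1 + y / (t - 2) = t / (t - 2) * (1 + (- ((2 - y) / t)))"
        using t(1) by (simp add: field_simps)
      then show ?thesis unfolding t(2,3) t_def .
    qed
    also have "\<dots> \<le> (?N + 3) / (?N + 1) * exp (- ((2 - y) / (?N + 3)))"
      by (intro mult_left_mono exp_ge_add_one_self) simp
    also have "\<dots> \<le> (?N + 3) / (?N + 1) * exp (- ((2 - y) * (ln (?N + 4) - ln (?N + 3))))"
      using mult_left_mono[OF ln, of "2 - y"] assms by (intro mult_left_mono) auto
    finally have step: "1 + y / real (Suc n) \<le> (?N + 3) / (?N + 1) * exp (- ((2 - y) * (ln (?N + 4) - ln (?N + 3))))" .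
    have "(\<Prod>j=1..Suc n. 1 + y / real j) = (\<Prod>j=1..n. 1 + y / real j) * (1 + y / real (Suc n))"
      by simp
    also have "\<dots> \<le> (real (Suc n) * real (Suc (Suc n)) / 2 * ?E (?N + 3))
        * ((?N + 3) / (?N + 1) * exp (- ((2 - y) * (ln (?N + 4) - ln (?N + 3)))))"
      using assms by (intro mult_mono Suc step) (auto intro!: mult_nonneg_nonneg)
    also have "\<dots> = (real (Suc n) * real (Suc (Suc n)) / 2 * ((?N + 3) / (?N + 1)))
        * (?E (?N + 3) * exp (- ((2 - y) * (ln (?N + 4) - ln (?N + 3)))))"
      by (simp only: mult_ac)
    also have "real (Suc n) * real (Suc (Suc n)) / 2 * ((?N + 3) / (?N + 1)) = real (Suc (Suc n)) * real (Suc (Suc (Suc n))) / 2"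
      by (simp add: field_simps)
    also have "?E (?N + 3) * exp (- ((2 - y) * (ln (?N + 4) - ln (?N + 3)))) = ?E (real (Suc n) + 3)"
      by (simp add: algebra_simps flip: exp_add)
    finally show ?case .
  qed simp
  also have "\<dots> \<le> real (Suc n) * real (Suc (Suc n)) / 2 * exp (- ((2 - y) * (ln (real (Suc n)) - ln 3)))"
    using assms by (intro mult_left_mono) (auto intro!: mult_left_mono)
  finally show ?thesis .
qed

text \<open>
  The weight \<open>h\<close> of the second moment bound. The square root comes from splitting the factor \<open>b\<close> as
  \<open>b \<le> sqrt a * sqrt b\<close> to make the double integral symmetric, and the exponential from the
  constant \<open>ln 3\<close> in \<open>prod_rising_upper\<close>. Both tend to \<open>1\<close> at time \<open>0\<close>.
\<close>

definition envelope :: "nat \<Rightarrow> real \<Rightarrow> real" where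
  "envelope k x = sqrt (surv k x) * exp ((1 - surv k x) * ln 3)"

lemma envelope_measurable [measurable]: "envelope k \<in> borel_measurable borel"
  unfolding envelope_def[abs_def] by measurable

lemma envelope_nonneg [simp]: "x \<ge> 0 \<Longrightarrow> 0 \<le> envelope k x"
  by (simp add: envelope_def)

lemma surv_le_exp_quarter:
  assumes "x \<ge> 0"
  shows "surv k x \<le> 2 ^ k * exp (- (x / 4))"
proof -
  have "surv k x \<le> 2 ^ k * exp (- (x / 2))" by (rule surv_le_exp[OF assms])
  also have "\<dots> \<le> 2 ^ k * exp (- (x / 4))" using assms by (intro mult_left_mono) auto
  finally show ?thesis .
qed

lemma envelope_bound:
  assumes "x \<ge> 0"
  shows "envelope k x \<le> (sqrt (2 ^ k) * 3) * exp (- (x / 4))"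
proof -
  have "sqrt (surv k x) \<le> sqrt (2 ^ k * exp (- (x / 2)))"
    by (intro real_sqrt_le_mono surv_le_exp assms)
  also have "exp (- (x / 2)) = (exp (- (x / 4)))\<^sup>2"
    by (simp add: power2_eq_square flip: exp_add)
  finally have 1: "sqrt (surv k x) \<le> sqrt (2 ^ k) * exp (- (x / 4))"
    by (simp add: real_sqrt_mult)
  have "(1 - surv k x) * ln 3 \<le> 1 * ln (3 :: real)"
    using assms by (intro mult_right_mono) auto
  then have "exp ((1 - surv k x) * ln 3) \<le> exp (ln (3 :: real))"
    by (subst exp_le_cancel_iff) simp
  then have "exp ((1 - surv k x) * ln 3) \<le> (3 :: real)" by simp
  then have "envelope k x \<le> (sqrt (2 ^ k) * exp (- (x / 4))) * 3"
    unfolding envelope_def using 1 assms by (intro mult_mono) auto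
  then show ?thesis by (simp add: mult_ac)
qed

lemma surv_tendsto_1: "k \<ge> 1 \<Longrightarrow> (surv k \<longlongrightarrow> 1) (at_right 0)"
  using isCont_surv[of 0 k] by (simp add: isCont_def surv_0_right filterlim_at_split)

lemma envelope_tendsto_1:
  assumes "k \<ge> 1"
  shows "(envelope k \<longlongrightarrow> 1) (at_right 0)"
proof -
  have "(envelope k \<longlongrightarrow> sqrt 1 * exp ((1 - 1) * ln 3)) (at_right 0)"
    unfolding envelope_def[abs_def] by (intro tendsto_intros surv_tendsto_1 assms)
  then show ?thesis by simp
qed

lemma nn_integral_laplace:
  assumes meas: "h \<in> borel_measurable borel" and h: "\<And>x. x \<ge> 0 \<Longrightarrow> 0 \<le> h x"
    and bound: "\<And>x. x \<ge> 0 \<Longrightarrow> h x \<le> B * exp (- (x / 4))" and L: "L \<ge> 0"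
  shows "(\<integral>\<^sup>+x\<in>{0..}. ennreal (h x * exp (- (L * (1 - surv k x)))) \<partial>lborel) = ennreal (laplace_integral k h L)"
    and "laplace_integral k h L \<ge> 0"
proof -
  have nn: "0 \<le> indicator {0..} x * (h x * exp (- (L * (1 - surv k x))))" for x
    using h by (auto simp: indicator_def)
  have "(\<integral>\<^sup>+x\<in>{0..}. ennreal (h x * exp (- (L * (1 - surv k x)))) \<partial>lborel)
      = (\<integral>\<^sup>+x. ennreal (indicator {0..} x * (h x * exp (- (L * (1 - surv k x))))) \<partial>lborel)"
    by (intro nn_integral_cong) (auto simp: indicator_def)
  also have "\<dots> = ennreal (laplace_integral k h L)"
    unfolding laplace_integral_def using nn by (intro nn_integral_eq_integral laplace_integrable[OF meas h bound L]) auto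
  finally show "(\<integral>\<^sup>+x\<in>{0..}. ennreal (h x * exp (- (L * (1 - surv k x)))) \<partial>lborel) = ennreal (laplace_integral k h L)" .
  show "laplace_integral k h L \<ge> 0"
    unfolding laplace_integral_def using nn by (intro Bochner_Integration.integral_nonneg) auto
qed

lemma mean_cut_number_rrt_ge:
  assumes "k > 0"
  shows "ennreal (real (Suc n) * laplace_integral k (surv k) (ln (real (Suc n))))
           \<le> (\<integral>\<^sup>+m. of_nat m \<partial>cut_number_rrt k (Suc n))"
proof -
  let ?N = "real (Suc n)"
  have "ennreal (?N * laplace_integral k (surv k) (ln ?N))
      = ennreal ?N * (\<integral>\<^sup>+x\<in>{0..}. ennreal (surv k x * exp (- (ln ?N * (1 - surv k x)))) \<partial>lborel)"
    by (subst nn_integral_laplace(1)[where B = "2 ^ k"]) (auto simp: surv_le_exp_quarter ennreal_mult')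
  also have "\<dots> = (\<integral>\<^sup>+x. ennreal ?N * (ennreal (surv k x * exp (- (ln ?N * (1 - surv k x)))) * indicator {0..} x) \<partial>lborel)"
    by (rule nn_integral_cmult[symmetric]) measurable
  also have "\<dots> \<le> (\<integral>\<^sup>+x\<in>{0..}. ennreal (surv k x * (\<Prod>j=1..n. 1 + surv k x / real j)) \<partial>lborel)"
  proof (rule nn_integral_mono)
    fix x :: real
    show "ennreal ?N * (ennreal (surv k x * exp (- (ln ?N * (1 - surv k x)))) * indicator {0..} x)
        \<le> ennreal (surv k x * (\<Prod>j=1..n. 1 + surv k x / real j)) * indicator {0..} x"
    proof (cases "x \<ge> 0")
      case True
      have "?N * exp (- (ln ?N * (1 - surv k x))) = exp (ln ?N) * exp (- (ln ?N * (1 - surv k x)))"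
        by simp
      also have "\<dots> = exp (surv k x * ln ?N)"
        by (simp only: exp_add[symmetric]) (simp add: algebra_simps)
      also have "\<dots> \<le> (\<Prod>j=1..n. 1 + surv k x / real j)"
        using True by (intro prod_rising_lower) (auto simp: surv_le_1)
      finally have "surv k x * (?N * exp (- (ln ?N * (1 - surv k x)))) \<le> surv k x * (\<Prod>j=1..n. 1 + surv k x / real j)"
        using True by (intro mult_left_mono) auto
      then have "ennreal (?N * (surv k x * exp (- (ln ?N * (1 - surv k x))))) \<le> ennreal (surv k x * (\<Prod>j=1..n. 1 + surv k x / real j))"
        by (intro ennreal_leI) (simp only: mult_ac)
      then show ?thesis using True by (simp add: ennreal_mult')
    qed simp
  qed
  also have "\<dots> = (\<integral>\<^sup>+m. of_nat m \<partial>cut_number_rrt k (Suc n))"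
    by (rule mean_cut_number_rrt[OF assms, symmetric])
  finally show ?thesis .
qed

lemma second_moment_cut_number_rrt_le_laplace:
  assumes "k > 0"
  shows "(\<integral>\<^sup>+m. of_nat (m * (m + 1)) \<partial>cut_number_rrt k (Suc n))
    \<le> ennreal (real (Suc n) * real (Suc (Suc n)) * (laplace_integral k (envelope k) (ln (real (Suc n))))\<^sup>2)"
proof -
  let ?N = "real (Suc n)" and ?N' = "real (Suc (Suc n))"
  define g where "g x = envelope k x * exp (- (ln ?N * (1 - surv k x)))" for x
  have [measurable]: "g \<in> borel_measurable borel" unfolding g_def[abs_def] by measurable
  have g: "0 \<le> g x" if "x \<ge> 0" for x using that by (simp add: g_def)
  have pointwise: "2 * surv k (x + r) * (\<Prod>j=1..n. 1 + (surv k x + surv k (x + r)) / real j)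
      \<le> ?N * ?N' * (g x * g (x + r))" if x: "x \<ge> 0" and r: "r > 0" for x r
  proof -
    define a b where "a = surv k x" and "b = surv k (x + r)"
    have ab: "0 \<le> b" "b \<le> a" "a \<le> 1"
      using x r by (auto simp: a_def b_def surv_le_1 intro!: surv_antimono)
    have "b = sqrt b * sqrt b" using ab by simp
    also have "\<dots> \<le> sqrt a * sqrt b" using ab by (intro mult_right_mono) auto
    finally have b: "b \<le> sqrt a * sqrt b" .
    have "2 * b * (\<Prod>j=1..n. 1 + (a + b) / real j)
        \<le> 2 * (sqrt a * sqrt b) * (?N * ?N' / 2 * exp (- ((2 - (a + b)) * (ln ?N - ln 3))))"
      using ab by (intro mult_mono mult_left_mono b prod_rising_upper) (auto intro!: prod_nonneg mult_nonneg_nonneg)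
    also have "\<dots> = ?N * ?N' * (sqrt a * sqrt b * exp (- ((2 - (a + b)) * (ln ?N - ln 3))))"
      by simp
    also have "exp (- ((2 - (a + b)) * (ln ?N - ln 3)))
        = (exp ((1 - a) * ln 3) * exp (- (ln ?N * (1 - a)))) * (exp ((1 - b) * ln 3) * exp (- (ln ?N * (1 - b))))"
      by (simp only: exp_add[symmetric]) (simp add: algebra_simps)
    also have "?N * ?N' * (sqrt a * sqrt b * \<dots>) = ?N * ?N' * (g x * g (x + r))"
      by (simp only: g_def envelope_def a_def[symmetric] b_def[symmetric] mult_ac)
    finally show ?thesis by (simp only: a_def b_def)
  qed
  have "(\<integral>\<^sup>+m. of_nat (m * (m + 1)) \<partial>cut_number_rrt k (Suc n))
     \<le> 2 * (\<integral>\<^sup>+r\<in>{0<..}. (\<integral>\<^sup>+x\<in>{0..}. ennreal (2 * surv k (x + r)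
            * (\<Prod>j=1..n. 1 + (surv k x + surv k (x + r)) / real j)) \<partial>lborel) \<partial>lborel)"
    by (rule second_moment_cut_number_rrt_le[OF assms])
  also have "\<dots> \<le> 2 * (\<integral>\<^sup>+r. ennreal (?N * ?N') * ((\<integral>\<^sup>+x\<in>{0..}. ennreal (g x) * ennreal (g (x + r)) \<partial>lborel) * indicator {0<..} r) \<partial>lborel)"
  proof (intro mult_left_mono nn_integral_mono)
    fix r :: real
    show "(\<integral>\<^sup>+x\<in>{0..}. ennreal (2 * surv k (x + r)
            * (\<Prod>j=1..n. 1 + (surv k x + surv k (x + r)) / real j)) \<partial>lborel) * indicator {0<..} r
        \<le> ennreal (?N * ?N') * ((\<integral>\<^sup>+x\<in>{0..}. ennreal (g x) * ennreal (g (x + r)) \<partial>lborel) * indicator {0<..} r)"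
    proof (cases "r > 0")
      case True
      have "(\<integral>\<^sup>+x\<in>{0..}. ennreal (2 * surv k (x + r)
            * (\<Prod>j=1..n. 1 + (surv k x + surv k (x + r)) / real j)) \<partial>lborel)
          \<le> (\<integral>\<^sup>+x. ennreal (?N * ?N') * (ennreal (g x) * ennreal (g (x + r)) * indicator {0..} x) \<partial>lborel)"
      proof (rule nn_integral_mono)
        fix x :: real
        show "ennreal (2 * surv k (x + r) * (\<Prod>j=1..n. 1 + (surv k x + surv k (x + r)) / real j)) * indicator {0..} x
            \<le> ennreal (?N * ?N') * (ennreal (g x) * ennreal (g (x + r)) * indicator {0..} x)"
        proof (cases "x \<ge> 0")
          case x: True
          have "ennreal (?N * ?N' * (g x * g (x + r))) = ennreal (?N * ?N') * (ennreal (g x) * ennreal (g (x + r)))"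
            using x True g by (simp add: ennreal_mult)
          then show ?thesis
            using ennreal_leI[OF pointwise[OF x True]] x by (simp del: of_nat_Suc)
        qed simp
      qed
      also have "\<dots> = ennreal (?N * ?N') * (\<integral>\<^sup>+x\<in>{0..}. ennreal (g x) * ennreal (g (x + r)) \<partial>lborel)"
        by (rule nn_integral_cmult) measurable
      finally show ?thesis using True by (simp del: of_nat_Suc)
    qed simp
  qed simp
  also have "\<dots> = ennreal (?N * ?N') * (2 * (\<integral>\<^sup>+r\<in>{0<..}. (\<integral>\<^sup>+x\<in>{0..}. ennreal (g x) * ennreal (g (x + r)) \<partial>lborel) \<partial>lborel))"
    by (subst nn_integral_cmult) (measurable, simp only: mult_ac)
  also have "\<dots> \<le> ennreal (?N * ?N') * (\<integral>\<^sup>+x\<in>{0..}. ennreal (g x) \<partial>lborel)\<^sup>2"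
    by (intro mult_left_mono double_integral_le_square) auto
  also have "(\<integral>\<^sup>+x\<in>{0..}. ennreal (g x) \<partial>lborel) = ennreal (laplace_integral k (envelope k) (ln ?N))"
    unfolding g_def by (rule nn_integral_laplace(1)[where B = "sqrt (2 ^ k) * 3"]) (auto intro: envelope_bound)
  also have "ennreal (?N * ?N') * (ennreal (laplace_integral k (envelope k) (ln ?N)))\<^sup>2
      = ennreal (?N * ?N' * (laplace_integral k (envelope k) (ln ?N))\<^sup>2)"
    by (subst ennreal_power[OF nn_integral_laplace(2)[where B = "sqrt (2 ^ k) * 3"]])
       (auto intro: envelope_bound simp: ennreal_mult)
  finally show ?thesis .
qed

text \<open>
  Convergence in probability to a constant implies convergence in distribution: the limiting
  distribution function jumps at \<open>c\<close> alone, so only points \<open>x \<noteq> c\<close> need to be considered, and there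
  the event on the wrong side of \<open>x\<close> forces a deviation of at least \<open>\<bar>x - c\<bar>\<close>.
\<close>

lemma weak_conv_m_return:
  fixes X :: "nat \<Rightarrow> 'a \<Rightarrow> real" and p :: "nat \<Rightarrow> 'a pmf"
  assumes conv: "\<And>e. e > 0 \<Longrightarrow> (\<lambda>n. measure_pmf.prob (p n) {m. e \<le> \<bar>X n m - c\<bar>}) \<longlonglongrightarrow> 0"
  shows "weak_conv_m (\<lambda>n. distr (measure_pmf (p n)) borel (X n)) (return borel c)"
  unfolding weak_conv_m_def weak_conv_def
proof (intro allI impI)
  fix x assume cont: "isCont (cdf (return borel c)) x"
  interpret R: prob_space "return borel c" by (intro prob_space_return) simp
  interpret R: finite_borel_measure "return borel c"
    by (intro finite_borel_measure.intro finite_borel_measure_axioms.intro R.finite_measure_axioms) simp_all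
  have "x \<noteq> c" using cont unfolding R.isCont_cdf by (auto simp: measure_return)
  have cdf_n: "cdf (distr (measure_pmf (p n)) borel (X n)) x = measure_pmf.prob (p n) {m. X n m \<le> x}" for n
    by (simp add: cdf_def measure_distr vimage_def)
  have cdf: "cdf (return borel c) x = indicator {..x} c"
    by (simp add: cdf_def measure_return)
  have lim: "(\<lambda>n. measure_pmf.prob (p n) {m. \<bar>x - c\<bar> \<le> \<bar>X n m - c\<bar>}) \<longlonglongrightarrow> 0"
    using \<open>x \<noteq> c\<close> by (intro conv) simp
  show "(\<lambda>n. cdf (distr (measure_pmf (p n)) borel (X n)) x) \<longlonglongrightarrow> cdf (return borel c) x"
  proof (cases "x < c")
    case True
    have "(\<lambda>n. measure_pmf.prob (p n) {m. X n m \<le> x}) \<longlonglongrightarrow> 0"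
    proof (rule tendsto_sandwich[OF _ _ tendsto_const lim])
      show "\<forall>\<^sub>F n in sequentially. measure_pmf.prob (p n) {m. X n m \<le> x}
          \<le> measure_pmf.prob (p n) {m. \<bar>x - c\<bar> \<le> \<bar>X n m - c\<bar>}"
        using True by (intro always_eventually allI measure_pmf.finite_measure_mono) auto
    qed simp
    then show ?thesis unfolding cdf_n cdf using True by simp
  next
    case False
    have "(\<lambda>n. measure_pmf.prob (p n) {m. X n m \<le> x}) \<longlonglongrightarrow> 1"
    proof (rule tendsto_sandwich[OF _ _ _ tendsto_const])
      show "\<forall>\<^sub>F n in sequentially. 1 - measure_pmf.prob (p n) {m. \<bar>x - c\<bar> \<le> \<bar>X n m - c\<bar>}
          \<le> measure_pmf.prob (p n) {m. X n m \<le> x}"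
      proof (intro always_eventually allI)
        fix n
        have "1 - measure_pmf.prob (p n) {m. \<bar>x - c\<bar> \<le> \<bar>X n m - c\<bar>}
            = measure_pmf.prob (p n) (- {m. \<bar>x - c\<bar> \<le> \<bar>X n m - c\<bar>})"
          using measure_pmf.prob_compl[of "{m. \<bar>x - c\<bar> \<le> \<bar>X n m - c\<bar>}" "p n"] by (simp add: Compl_eq_Diff_UNIV)
        also have "\<dots> \<le> measure_pmf.prob (p n) {m. X n m \<le> x}"
          using False by (intro measure_pmf.finite_measure_mono) auto
        finally show "1 - measure_pmf.prob (p n) {m. \<bar>x - c\<bar> \<le> \<bar>X n m - c\<bar>}
            \<le> measure_pmf.prob (p n) {m. X n m \<le> x}" .
      qed
      show "(\<lambda>n. 1 - measure_pmf.prob (p n) {m. \<bar>x - c\<bar> \<le> \<bar>X n m - c\<bar>}) \<longlonglongrightarrow> 1"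
        using tendsto_diff[OF tendsto_const[of "1::real"] lim] by simp
    qed simp
    then show ?thesis unfolding cdf_n cdf using False by simp
  qed
qed

text \<open>
  Chebyshev's inequality around a prescribed constant rather than the mean. A lower
  bound for the first moment and an upper bound for the second suffice, because the mean enters
  the expanded square with a negative sign.
\<close>

lemma chebyshev_around:
  fixes p :: "nat pmf" and a b c s e :: real
  assumes mean: "ennreal a \<le> (\<integral>\<^sup>+m. of_nat m \<partial>p)"
    and second: "(\<integral>\<^sup>+m. of_nat (m * (m + 1)) \<partial>p) \<le> ennreal b"
    and "s \<ge> 0" "c \<ge> 0" "e > 0" "b \<ge> 0"
  shows "measure_pmf.prob p {m. e \<le> \<bar>s * real m - c\<bar>} \<le> (s\<^sup>2 * b - 2 * c * (s * a) + c\<^sup>2) / e\<^sup>2"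
proof -
  have nn2: "(\<integral>\<^sup>+m. ennreal (real (m * (m + 1))) \<partial>p) \<le> ennreal b"
    using second by (simp only: ennreal_of_nat_eq_real_of_nat)
  have int2: "integrable (measure_pmf p) (\<lambda>m. real (m * (m + 1)))"
    using nn2 by (intro integrableI_bounded) (auto intro: le_less_trans)
  have int1: "integrable (measure_pmf p) real"
    by (rule Bochner_Integration.integrable_bound[OF int2]) (auto intro!: AE_I2 simp flip: of_nat_mult)
  have intsq: "integrable (measure_pmf p) (\<lambda>m. (real m)\<^sup>2)"
    by (rule Bochner_Integration.integrable_bound[OF int2]) (auto intro!: AE_I2 simp: power2_eq_square algebra_simps)
  have E1: "a \<le> (\<integral>m. real m \<partial>p)"
  proof -
    have "ennreal a \<le> ennreal (\<integral>m. real m \<partial>p)"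
      using mean nn_integral_eq_integral[OF int1] by (simp add: ennreal_of_nat_eq_real_of_nat)
    then show ?thesis
      by (subst (asm) ennreal_le_iff) (auto intro: Bochner_Integration.integral_nonneg)
  qed
  have "(\<integral>m. (real m)\<^sup>2 \<partial>p) \<le> (\<integral>m. real (m * (m + 1)) \<partial>p)"
    by (rule integral_mono[OF intsq int2]) (simp add: power2_eq_square algebra_simps)
  also have "\<dots> \<le> b"
  proof -
    have "ennreal (\<integral>m. real (m * (m + 1)) \<partial>p) \<le> ennreal b"
      using nn2 nn_integral_eq_integral[OF int2] by simp
    then show ?thesis using \<open>b \<ge> 0\<close> by (subst (asm) ennreal_le_iff) auto
  qed
  finally have E2: "(\<integral>m. (real m)\<^sup>2 \<partial>p) \<le> b" .
  have sq: "(s * real m - c)\<^sup>2 = s\<^sup>2 * (real m)\<^sup>2 - 2 * c * s * real m + c\<^sup>2" for m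
    by (simp add: power2_eq_square algebra_simps)
  have int: "integrable (measure_pmf p) (\<lambda>m. (s * real m - c)\<^sup>2)"
    unfolding sq using int1 intsq by (intro Bochner_Integration.integrable_add Bochner_Integration.integrable_diff integrable_mult_right) auto
  have "(\<integral>m. (s * real m - c)\<^sup>2 \<partial>p) = s\<^sup>2 * (\<integral>m. (real m)\<^sup>2 \<partial>p) - 2 * c * s * (\<integral>m. real m \<partial>p) + c\<^sup>2"
    unfolding sq using int1 intsq by simp
  also have "\<dots> \<le> s\<^sup>2 * b - 2 * c * s * a + c\<^sup>2"
    using E1 E2 assms by (intro add_mono diff_mono mult_left_mono) auto
  finally have var: "(\<integral>m. (s * real m - c)\<^sup>2 \<partial>p) \<le> s\<^sup>2 * b - 2 * c * (s * a) + c\<^sup>2"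
    by (simp add: mult_ac)
  have "{m. e \<le> \<bar>s * real m - c\<bar>} = {m \<in> space (measure_pmf p). e\<^sup>2 \<le> (s * real m - c)\<^sup>2}"
    using \<open>e > 0\<close> abs_le_square_iff[of e "s * real _ - c"] by auto
  then have "measure_pmf.prob p {m. e \<le> \<bar>s * real m - c\<bar>} = measure_pmf.prob p {m \<in> space (measure_pmf p). e\<^sup>2 \<le> (s * real m - c)\<^sup>2}"
    by simp
  also have "\<dots> \<le> (\<integral>m. (s * real m - c)\<^sup>2 \<partial>p) / e\<^sup>2"
    using \<open>e > 0\<close> by (intro integral_Markov_inequality_measure[OF int, of "{}"]) auto
  also have "\<dots> \<le> (s\<^sup>2 * b - 2 * c * (s * a) + c\<^sup>2) / e\<^sup>2"
    by (intro divide_right_mono var) simp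
  finally show ?thesis .
qed

theorem mainTheorem4:
  fixes k :: nat
  assumes "k \<ge> 2"
  shows "weak_conv_m
           (\<lambda>n. distr (measure_pmf (cut_number_rrt k n)) borel
                  (\<lambda>m. inverse (real n) * ln (real n) powr (1 / real k) * real m))
           (return borel (fact k powr (1 / real k) * Gamma (1 + 1 / real k)))"
proof (rule weak_conv_m_return)
  fix e :: real assume e: "e > 0"
  have k: "k \<ge> 1" "k > 0" using assms by auto
  define c where "c = fact k powr (1 / real k) * Gamma (1 + 1 / real k)"
  have c: "c \<ge> 0" unfolding c_def
    by (intro mult_nonneg_nonneg Gamma_real_nonneg) (auto intro: add_pos_nonneg)
  define A where "A n = laplace_integral k (surv k) (ln (real n))" for n
  define C where "C n = laplace_integral k (envelope k) (ln (real n))" for n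
  define s where "s n = inverse (real n) * ln (real n) powr (1 / real k)" for n
  have ln_lim: "filterlim (\<lambda>n. ln (real n)) at_top sequentially"
    by real_asymp
  have A_lim: "(\<lambda>n. ln (real n) powr (1 / real k) * A n) \<longlonglongrightarrow> c"
    unfolding A_def c_def
    by (rule filterlim_compose[OF laplace_method[where B = "2 ^ k"] ln_lim])
       (use k in \<open>auto simp: surv_le_exp_quarter surv_tendsto_1\<close>)
  have C_lim: "(\<lambda>n. ln (real n) powr (1 / real k) * C n) \<longlonglongrightarrow> c"
    unfolding C_def c_def
    by (rule filterlim_compose[OF laplace_method[where B = "sqrt (2 ^ k) * 3"] ln_lim])
       (use k in \<open>auto simp: envelope_tendsto_1 intro: envelope_bound\<close>)
  \<comment> \<open>the bound for the mean squared distance from \<open>c\<close>; it tends to \<open>c\<^sup>2 - 2 c\<^sup>2 + c\<^sup>2 = 0\<close>\<close>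
  define V where "V n = (1 + 1 / real n) * (ln (real n) powr (1 / real k) * C n)\<^sup>2
      - 2 * c * (ln (real n) powr (1 / real k) * A n) + c\<^sup>2" for n
  have "(\<lambda>n. 1 + 1 / real n) \<longlonglongrightarrow> 1"
    by real_asymp
  then have "V \<longlonglongrightarrow> 1 * c\<^sup>2 - 2 * c * c + c\<^sup>2"
    unfolding V_def[abs_def] by (intro tendsto_intros A_lim C_lim)
  then have "V \<longlonglongrightarrow> 0" by (simp add: power2_eq_square)
  then have V_lim: "(\<lambda>n. V n / e\<^sup>2) \<longlonglongrightarrow> 0"
    by (rule tendsto_divide_zero)
  have bound: "measure_pmf.prob (cut_number_rrt k n) {m. e \<le> \<bar>s n * real m - c\<bar>} \<le> V n / e\<^sup>2"
    if n_pos: "n \<ge> 1" for n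
  proof -
    obtain n' where n: "n = Suc n'" using n_pos by (cases n) auto
    have "measure_pmf.prob (cut_number_rrt k n) {m. e \<le> \<bar>s n * real m - c\<bar>}
        \<le> ((s n)\<^sup>2 * (real n * real (Suc n) * (C n)\<^sup>2) - 2 * c * (s n * (real n * A n)) + c\<^sup>2) / e\<^sup>2"
      unfolding n A_def C_def
      by (rule chebyshev_around[OF mean_cut_number_rrt_ge[OF k(2)] second_moment_cut_number_rrt_le_laplace[OF k(2)] _ c e])
         (auto simp: s_def)
    also have "s n * (real n * A n) = ln (real n) powr (1 / real k) * A n"
      using n_pos by (simp add: s_def)
    also have "(s n)\<^sup>2 * (real n * real (Suc n) * (C n)\<^sup>2)
        = (1 + 1 / real n) * (ln (real n) powr (1 / real k) * C n)\<^sup>2"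
      using n_pos by (simp add: s_def power2_eq_square field_simps)
    finally show ?thesis by (simp add: V_def)
  qed
  have "(\<lambda>n. measure_pmf.prob (cut_number_rrt k n) {m. e \<le> \<bar>s n * real m - c\<bar>}) \<longlonglongrightarrow> 0"
  proof (rule tendsto_sandwich[OF _ _ tendsto_const V_lim])
    show "\<forall>\<^sub>F n in sequentially. measure_pmf.prob (cut_number_rrt k n) {m. e \<le> \<bar>s n * real m - c\<bar>} \<le> V n / e\<^sup>2"
      using eventually_ge_at_top[of 1] by eventually_elim (rule bound)
  qed simp
  then show "(\<lambda>n. measure_pmf.prob (cut_number_rrt k n)
      {m. e \<le> \<bar>inverse (real n) * ln (real n) powr (1 / real k) * real m
                - fact k powr (1 / real k) * Gamma (1 + 1 / real k)\<bar>}) \<longlonglongrightarrow> 0"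
    unfolding s_def c_def .
qed

end
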